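(* Let $k$ be an infinite field and let $G$ be the infinite dimensional unitary Grassmann algebra over $k$. If $k$ has characteristic zero, then $$CP(G)=\{[x_1,x_2],\ [x_1,x_2][x_3,x_4]\}^S,$$ while if $k$ has characteristic $p>2$, then $$CP(G)=\{[x_1,x_2],\ x_1^p,\ [x_1,x_2][x_3,x_4]\}^S+\{x_{2n+1}^pw_n\mid n\ge 1\}^S,$$ where for each $n\ge1$, $w_n=\prod_{k=1}^n [x_{2k-1},x_{2k}]x_{2k-1}^{p-1}x_{2k}^{p-1}$.
   Context: $X=\{x_i\mid i\ge 1\}$ is a countably infinite set; $k_0\langle X\rangle$ is the free nonunitary associative $k$-algebra over $X$ and $k_1\langle X\rangle$ is the free unitary associative $k$-algebra over $X$ (so $k_1\langle X\rangle = k\oplus k_0\langle X\rangle$). $[u,v]=uv-vu$. A $T$-space of $k_1\langle X\rangle$ is a linear subspace invariant under every (unital) endomorphism of $k_1\langle X\rangle$; for $Y\subseteq k_1\langle X\rangle$, $Y^S$ is the smallest $T$-space of $k_1\langle X\rangle$ containing $Y$. $G$ is the unital associative $k$-algebra generated by $e_i$, $i\ge1$, with $e_ie_j=-e_je_i$ and $e_i^2=0$ for all $i,j$, and with linear basis $\{1\}\cup\{e_{i_1}e_{i_2}\cdots e_{i_n}\mid n\ge 1,\ i_1<i_2<\cdots<i_n\}$. $T(G)$ is the set of identities of $G$: the elements lying in the kernel of every (unital) homomorphism $k_1\langle X\rangle\to G$. A central polynomial of $G$ is an element $f\in k_0\langle X\rangle$ with $f\notin T(G)$ whose image under every homomorphism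 $k_1\langle X\rangle\to G$ lies in the centre of $G$. (Note that central polynomials are by definition elements of $k_0\langle X\rangle$, i.e. have zero constant term.) $CP(G)$ is the $T$-space of $k_1\langle X\rangle$ generated by the central polynomials of $G$. *)

theory Defs
  imports Complex_Main "HOL-Library.Poly_Mapping"
begin

section \<open>The free unital associative algebra\<close>

text \<open>The free monoid on \<open>'v\<close>, written additively so that \<open>'v word \<Rightarrow>\<^sub>0 'k\<close> with the
  convolution product of \<^theory>\<open>HOL-Library.Poly_Mapping\<close> is its monoid algebra, i.e. the free unital
  associative algebra.\<close>

datatype 'v word = Word (letters: "'v list")

instantiation word :: (type) monoid_add
begin

definition "0 = Word []"

definition "u + v = Word (letters u @ letters v)"

instance
  by standard (auto simp: zero_word_def plus_word_def)

end

text \<open>The countably infinite alphabet is \<open>{x\<^sub>i | i \<ge> 1}\<close>; \<open>x\<^sub>i\<close> is the letter \<open>i - 1\<close>,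
  and \<open>var 0\<close> is never used.\<close>

type_synonym 'k free_algebra = "nat word \<Rightarrow>\<^sub>0 'k"

definition free_scale :: "'k::field \<Rightarrow> 'k free_algebra \<Rightarrow> 'k free_algebra" where
  "free_scale c f = Poly_Mapping.map ((*) c) f"

definition var :: "nat \<Rightarrow> 'k::field free_algebra" where
  "var i = Poly_Mapping.single (Word [i - 1]) 1"

text \<open>The nonunitary free algebra, as the augmentation ideal of the unitary one.\<close>

definition free_algebra0 :: "'k::field free_algebra set" where
  "free_algebra0 = {f. Poly_Mapping.lookup f 0 = 0}"

definition commutator :: "'a::ring \<Rightarrow> 'a \<Rightarrow> 'a" where
  "commutator u v = u * v - v * u"

lemma lookup_free_scale: "Poly_Mapping.lookup (free_scale c f) w = c * Poly_Mapping.lookup f w"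
  by (simp add: free_scale_def Poly_Mapping.map.rep_eq when_def)

lemma free_scale_conv_mult: "free_scale c f = Poly_Mapping.single 0 c * f"
  by (simp add: free_scale_def mult_map_scale_conv_mult)

lemma vector_space_free_scale: "vector_space free_scale"
  by standard
    (auto intro!: poly_mapping_eqI simp: lookup_free_scale lookup_add algebra_simps)

section \<open>Algebra homomorphisms, T-spaces and central polynomials\<close>

definition alg_hom ::
  "('k::field \<Rightarrow> 'a::ring_1 \<Rightarrow> 'a) \<Rightarrow> ('k \<Rightarrow> 'b::ring_1 \<Rightarrow> 'b) \<Rightarrow> ('a \<Rightarrow> 'b) \<Rightarrow> bool" where
  "alg_hom s1 s2 \<phi> \<longleftrightarrow>
     Vector_Spaces.linear s1 s2 \<phi> \<and> \<phi> 1 = 1 \<and> (\<forall>a b. \<phi> (a * b) = \<phi> a * \<phi> b)"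

definition T_space :: "'k::field free_algebra set \<Rightarrow> bool" where
  "T_space V \<longleftrightarrow> module.subspace free_scale V \<and>
     (\<forall>\<phi>. alg_hom free_scale free_scale \<phi> \<longrightarrow> \<phi> ` V \<subseteq> V)"

definition T_space_gen :: "'k::field free_algebra set \<Rightarrow> 'k free_algebra set" where
  "T_space_gen Y = T_space hull Y"

lemma T_space_T_space_gen: "T_space (T_space_gen Y)"
  unfolding T_space_gen_def
proof (rule hull_in)
  interpret vector_space "free_scale :: 'a \<Rightarrow> _" by (rule vector_space_free_scale)
  show "T_space (\<Inter>\<V>)" if "\<forall>V\<in>\<V>. T_space V" for \<V> :: "'a free_algebra set set"
    using that unfolding T_space_def by (blast intro!: subspace_Inter)
qed

definition identities :: "('k::field \<Rightarrow> 'a::ring_1 \<Rightarrow> 'a) \<Rightarrow> 'k free_algebra set" where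
  "identities s = {f. \<forall>\<phi>. alg_hom free_scale s \<phi> \<longrightarrow> \<phi> f = 0}"

definition center :: "'a::ring_1 set" where
  "center = {z. \<forall>a. z * a = a * z}"

definition central_polynomials :: "('k::field \<Rightarrow> 'a::ring_1 \<Rightarrow> 'a) \<Rightarrow> 'k free_algebra set" where
  "central_polynomials s =
     {f \<in> free_algebra0. f \<notin> identities s \<and> (\<forall>\<phi>. alg_hom free_scale s \<phi> \<longrightarrow> \<phi> f \<in> center)}"

definition CP :: "('k::field \<Rightarrow> 'a::ring_1 \<Rightarrow> 'a) \<Rightarrow> 'k free_algebra set" where
  "CP s = T_space_gen (central_polynomials s)"

section \<open>The infinite dimensional unitary Grassmann algebra\<close>

text \<open>An element is given by its coordinates with respect to the basis of all
  \<open>e\<^sub>A = e\<^bsub>i\<^sub>1\<^esub> \<cdots> e\<^bsub>i\<^sub>n\<^esub>\<close>, where \<open>A = {i\<^sub>1 < \<cdots> < i\<^sub>n}\<close> is a finite set of naturals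
  (so the generators are numbered from \<open>0\<close>).\<close>

typedef (overloaded) 'k grassmann =
  "{f :: nat set \<Rightarrow> 'k::zero. finite {A. f A \<noteq> 0} \<and> (\<forall>A. f A \<noteq> 0 \<longrightarrow> finite A)}"
  morphisms coord Abs_grassmann
  by (rule exI[of _ "\<lambda>_. 0"]) auto

setup_lifting type_definition_grassmann

lemma grassmann_eqI: "(\<And>A. finite A \<Longrightarrow> coord a A = coord b A) \<Longrightarrow> a = b"
  by transfer (metis ext)

lemma coord_infinite: "infinite A \<Longrightarrow> coord a A = 0"
  by transfer auto

text \<open>The number of transpositions sorting the concatenation of the increasing enumerations of
  \<open>A\<close> and \<open>B\<close>, so \<open>e\<^sub>A e\<^sub>B = (-1)\<^bsup>inversions A B\<^esup> e\<^bsub>A \<union> B\<^esub>\<close> for disjoint \<open>A\<close> and \<open>B\<close>.\<close>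

definition inversions :: "nat set \<Rightarrow> nat set \<Rightarrow> nat" where
  "inversions A B = card {(a, b) \<in> A \<times> B. b < a}"

lemma inversions_Un_left:
  assumes "finite A" "finite B" "finite C" "A \<inter> B = {}"
  shows "inversions (A \<union> B) C = inversions A C + inversions B C"
proof -
  have "{(a, c) \<in> (A \<union> B) \<times> C. c < a} = {(a, c) \<in> A \<times> C. c < a} \<union> {(a, c) \<in> B \<times> C. c < a}"
    by auto
  moreover have "finite {(a, c) \<in> A \<times> C. c < a}" "finite {(a, c) \<in> B \<times> C. c < a}"
    by (rule finite_subset[of _ "A \<times> C"], use assms in auto)
       (rule finite_subset[of _ "B \<times> C"], use assms in auto)
  ultimately show ?thesis
    unfolding inversions_def using assms(4) by (subst card_Un_disjoint[symmetric]) auto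
qed

lemma inversions_Un_right:
  assumes "finite A" "finite B" "finite C" "B \<inter> C = {}"
  shows "inversions A (B \<union> C) = inversions A B + inversions A C"
proof -
  have "{(a, c) \<in> A \<times> (B \<union> C). c < a} = {(a, c) \<in> A \<times> B. c < a} \<union> {(a, c) \<in> A \<times> C. c < a}"
    by auto
  moreover have "finite {(a, c) \<in> A \<times> B. c < a}" "finite {(a, c) \<in> A \<times> C. c < a}"
    by (rule finite_subset[of _ "A \<times> B"], use assms in auto)
       (rule finite_subset[of _ "A \<times> C"], use assms in auto)
  ultimately show ?thesis
    unfolding inversions_def using assms(4) by (subst card_Un_disjoint[symmetric]) auto
qed

lemma inversions_empty [simp]: "inversions {} A = 0" "inversions A {} = 0"
  by (simp_all add: inversions_def)

instantiation grassmann :: (ring_1) ring_1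
begin

lift_definition zero_grassmann :: "'a grassmann" is "\<lambda>_. 0" by simp

lift_definition one_grassmann :: "'a grassmann" is "\<lambda>A. if A = {} then 1 else 0"
  by (auto intro: finite_subset[of _ "{{}}"])

lift_definition plus_grassmann :: "'a grassmann \<Rightarrow> 'a grassmann \<Rightarrow> 'a grassmann"
  is "\<lambda>f g A. f A + g A"
proof -
  fix f g :: "nat set \<Rightarrow> 'a"
  assume "finite {A. f A \<noteq> 0} \<and> (\<forall>A. f A \<noteq> 0 \<longrightarrow> finite A)"
    and "finite {A. g A \<noteq> 0} \<and> (\<forall>A. g A \<noteq> 0 \<longrightarrow> finite A)"
  then show "finite {A. f A + g A \<noteq> 0} \<and> (\<forall>A. f A + g A \<noteq> 0 \<longrightarrow> finite A)"
    by (intro conjI finite_subset[of "{A. f A + g A \<noteq> 0}" "{A. f A \<noteq> 0} \<union> {A. g A \<noteq> 0}"])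
       (auto, metis add.right_neutral)
qed

lift_definition uminus_grassmann :: "'a grassmann \<Rightarrow> 'a grassmann" is "\<lambda>f A. - f A"
  by simp

definition minus_grassmann :: "'a grassmann \<Rightarrow> 'a grassmann \<Rightarrow> 'a grassmann" where
  "minus_grassmann a b = a + - b"

lift_definition times_grassmann :: "'a grassmann \<Rightarrow> 'a grassmann \<Rightarrow> 'a grassmann"
  is "\<lambda>f g C. \<Sum>A\<in>Pow C. (-1) ^ inversions A (C - A) * f A * g (C - A)"
proof -
  fix f g :: "nat set \<Rightarrow> 'a"
  assume f: "finite {A. f A \<noteq> 0} \<and> (\<forall>A. f A \<noteq> 0 \<longrightarrow> finite A)"
    and g: "finite {A. g A \<noteq> 0} \<and> (\<forall>A. g A \<noteq> 0 \<longrightarrow> finite A)"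
  let ?h = "\<lambda>C. \<Sum>A\<in>Pow C. (-1) ^ inversions A (C - A) * f A * g (C - A)"
  have "C \<in> (\<lambda>(A, B). A \<union> B) ` ({A. f A \<noteq> 0} \<times> {A. g A \<noteq> 0})" if nz: "?h C \<noteq> 0" for C
  proof -
    obtain A where "A \<in> Pow C" "(-1) ^ inversions A (C - A) * f A * g (C - A) \<noteq> 0"
      using nz by (rule sum.not_neutral_contains_not_neutral)
    then have "A \<subseteq> C" "f A \<noteq> 0" "g (C - A) \<noteq> 0"
      by auto
    then show ?thesis
      by (intro image_eqI[of _ _ "(A, C - A)"]) auto
  qed
  then have "{C. ?h C \<noteq> 0} \<subseteq> (\<lambda>(A, B). A \<union> B) ` ({A. f A \<noteq> 0} \<times> {A. g A \<noteq> 0})"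
    by blast
  then have "finite {C. ?h C \<noteq> 0}"
    by (rule finite_subset) (use f g in blast)
  moreover have "finite C" if "?h C \<noteq> 0" for C
    using that by (metis finite_Pow_iff sum.infinite)
  ultimately show "finite {C. ?h C \<noteq> 0} \<and> (\<forall>C. ?h C \<noteq> 0 \<longrightarrow> finite C)"
    by blast
qed

instance
proof
  fix a b c :: "'a grassmann"
  have minus_one_commute: "(-1) ^ n * r = r * (-1) ^ n" for n and r :: 'a
    by (cases "even n") auto
  show "a + b + c = a + (b + c)" "a + b = b + a" "0 + a = a" "- a + a = 0" "a - b = a + - b"
    by (auto simp: minus_grassmann_def) (transfer; simp add: fun_eq_iff algebra_simps)+
  show "(0 :: 'a grassmann) \<noteq> 1"
    by transfer (auto simp: fun_eq_iff)
  show "(a + b) * c = a * c + b * c" "a * (b + c) = a * b + a * c"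
    by (transfer; simp add: fun_eq_iff algebra_simps sum.distrib)+
  show "1 * a = a"
  proof (rule grassmann_eqI)
    fix C :: "nat set" assume C: "finite C"
    have "coord (1 * a) C = (\<Sum>A\<in>Pow C. if A = {} then coord a C else 0)"
      unfolding times_grassmann.rep_eq one_grassmann.rep_eq by (intro sum.cong) auto
    also have "\<dots> = coord a C"
      using C by simp
    finally show "coord (1 * a) C = coord a C" .
  qed
  show "a * 1 = a"
  proof (rule grassmann_eqI)
    fix C :: "nat set" assume C: "finite C"
    have "coord (a * 1) C = (\<Sum>A\<in>Pow C. if A = C then coord a C else 0)"
      unfolding times_grassmann.rep_eq one_grassmann.rep_eq by (intro sum.cong) auto
    also have "\<dots> = coord a C"
      using C by simp
    finally show "coord (a * 1) C = coord a C" .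
  qed
  show "a * b * c = a * (b * c)"
  proof (rule grassmann_eqI)
    fix D :: "nat set" assume D: "finite D"
    note fin = finite_subset[OF _ D]
    let ?s = "\<lambda>A B. (-1) ^ inversions A B :: 'a"
    have "coord (a * b * c) D =
      (\<Sum>C\<in>Pow D. \<Sum>A\<in>Pow C. ?s C (D - C) * (?s A (C - A) * coord a A * coord b (C - A)) * coord c (D - C))"
      unfolding times_grassmann.rep_eq by (simp add: sum_distrib_left sum_distrib_right)
    also have "\<dots> = (\<Sum>(C, A)\<in>Sigma (Pow D) Pow.
        ?s C (D - C) * (?s A (C - A) * coord a A * coord b (C - A)) * coord c (D - C))"
      by (subst sum.Sigma) (use D fin in auto)
    also have "\<dots> = (\<Sum>(A, B)\<in>Sigma (Pow D) (\<lambda>A. Pow (D - A)).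
        ?s A (D - A) * coord a A * (?s B (D - A - B) * coord b B * coord c (D - A - B)))"
    proof (rule sum.reindex_bij_witness[of _ "\<lambda>(A, B). (A \<union> B, A)" "\<lambda>(C, A). (A, C - A)"];
        clarsimp)
      fix C A assume CD: "C \<subseteq> D" and AC: "A \<subseteq> C"
      have eq: "D - A = (C - A) \<union> (D - C)" "C = A \<union> (C - A)" "D - A - (C - A) = D - C"
        using CD AC by auto
      have "inversions A (D - A) = inversions A (C - A) + inversions A (D - C)"
        unfolding eq(1) by (rule inversions_Un_right) (use CD AC fin in \<open>auto\<close>)
      moreover have "inversions C (D - C) = inversions A (D - C) + inversions (C - A) (D - C)"
      proof -
        have "inversions (A \<union> (C - A)) (D - C) = inversions A (D - C) + inversions (C - A) (D - C)"
          by (rule inversions_Un_left) (use CD AC fin in \<open>auto\<close>)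
        then show ?thesis
          using eq(2) by (rule ssubst[where P = "\<lambda>X. inversions X (D - C) = _", rotated])
      qed
      ultimately have sgn: "?s A (D - A) * ?s (C - A) (D - C) = ?s C (D - C) * ?s A (C - A)"
        by (simp add: power_add[symmetric] ac_simps)
      have "?s A (D - A) * coord a A * (?s (C - A) (D - C) * coord b (C - A) * coord c (D - C))
          = ?s A (D - A) * (coord a A * ?s (C - A) (D - C)) * coord b (C - A) * coord c (D - C)"
        by (simp only: mult.assoc)
      also have "\<dots> = (?s A (D - A) * ?s (C - A) (D - C)) * coord a A * coord b (C - A) * coord c (D - C)"
        by (simp only: mult.assoc minus_one_commute[of _ "coord a A", symmetric])
      finally have "?s A (D - A) * coord a A * (?s (C - A) (D - C) * coord b (C - A) * coord c (D - C))
          = (?s A (D - A) * ?s (C - A) (D - C)) * coord a A * coord b (C - A) * coord c (D - C)" .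
      then show "?s A (D - A) * coord a A *
          (?s (C - A) (D - A - (C - A)) * coord b (C - A) * coord c (D - A - (C - A))) =
        ?s C (D - C) * (?s A (C - A) * coord a A * coord b (C - A)) * coord c (D - C)"
        unfolding eq(3) sgn by (simp add: mult.assoc)
    qed auto
    also have "\<dots> = (\<Sum>A\<in>Pow D. \<Sum>B\<in>Pow (D - A).
        ?s A (D - A) * coord a A * (?s B (D - A - B) * coord b B * coord c (D - A - B)))"
      by (subst sum.Sigma) (use D fin in auto)
    also have "\<dots> = coord (a * (b * c)) D"
      unfolding times_grassmann.rep_eq by (simp add: sum_distrib_left)
    finally show "coord (a * b * c) D = coord (a * (b * c)) D" .
  qed
qed

end

lift_definition grassmann_scale :: "'k::field \<Rightarrow> 'k grassmann \<Rightarrow> 'k grassmann"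
  is "\<lambda>c f A. c * f A"
  by (auto intro: finite_subset)

lift_definition grassmann_basis :: "nat set \<Rightarrow> 'k::field grassmann"
  is "\<lambda>A B. if finite A \<and> A = B then 1 else 0"
  by (auto intro: finite_subset[of _ "{_}"])

definition grassmann_gen :: "nat \<Rightarrow> 'k::field grassmann" where
  "grassmann_gen i = grassmann_basis {i}"

text \<open>The following facts are the defining properties of the Grassmann algebra.\<close>

lemma vector_space_grassmann_scale: "vector_space grassmann_scale"
  by standard (transfer; simp add: fun_eq_iff algebra_simps)+

lemma grassmann_scale_mult:
  "grassmann_scale c (a * b) = grassmann_scale c a * b"
  "grassmann_scale c (a * b) = a * grassmann_scale c b"
  by (transfer; simp add: sum_distrib_left algebra_simps)+

lemma grassmann_basis_mult:
  assumes "finite A" "finite B"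
  shows "grassmann_basis A * grassmann_basis B =
    (if A \<inter> B = {} then grassmann_scale ((-1) ^ inversions A B) (grassmann_basis (A \<union> B)) else 0)"
proof (rule grassmann_eqI)
  fix C :: "nat set" assume C: "finite C"
  have "coord (grassmann_basis A * grassmann_basis B :: 'a grassmann) C =
    (\<Sum>A'\<in>Pow C. if A' = A then (if B = C - A then (-1) ^ inversions A B else 0) else 0)"
    unfolding times_grassmann.rep_eq
    by (intro sum.cong) (simp_all add: grassmann_basis.rep_eq assms)
  also have "\<dots> = (if A \<subseteq> C \<and> B = C - A then (-1) ^ inversions A B else 0)"
    using C by (simp add: sum.delta)
  also have "A \<subseteq> C \<and> B = C - A \<longleftrightarrow> A \<inter> B = {} \<and> C = A \<union> B"
    by blast
  finally show "coord (grassmann_basis A * grassmann_basis B :: 'a grassmann) C =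
      coord (if A \<inter> B = {} then grassmann_scale ((-1) ^ inversions A B) (grassmann_basis (A \<union> B)) else 0) C"
    by (cases "A \<inter> B = {}"; cases "C = A \<union> B")
      (simp_all add: grassmann_scale.rep_eq grassmann_basis.rep_eq zero_grassmann.rep_eq assms
        eq_commute[of "A \<union> B"])
qed

lemma grassmann_basis_empty: "grassmann_basis {} = 1"
  by transfer (auto simp: fun_eq_iff)

lemma grassmann_gen_square: "grassmann_gen i ^ 2 = 0"
  by (simp add: grassmann_gen_def power2_eq_square grassmann_basis_mult)

lemma inversions_singletons: "inversions {i} {j} = (if j < i then 1 else 0)"
proof -
  have "{(a, b) \<in> {i} \<times> {j}. b < a} = (if j < i then {(i, j)} else {})"
    by auto
  then show ?thesis
    unfolding inversions_def by (auto split: if_splits)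
qed

lemma grassmann_scale_minus_one: "grassmann_scale (- 1) a = - a"
  by transfer simp

lemma grassmann_scale_one: "grassmann_scale 1 a = a"
  by transfer simp

lemma grassmann_gen_anticommute:
  "grassmann_gen i * grassmann_gen j = - (grassmann_gen j * grassmann_gen i)"
  by (cases i j rule: linorder_cases)
    (simp_all add: grassmann_gen_def grassmann_basis_mult inversions_singletons
      grassmann_scale_minus_one grassmann_scale_one insert_commute[of i j])

lemma prod_list_grassmann_gen:
  "sorted_wrt (<) js \<Longrightarrow> prod_list (map grassmann_gen js) = grassmann_basis (set js)"
proof (induction js)
  case Nil
  then show ?case by (simp add: grassmann_basis_empty)
next
  case (Cons i js)
  then have lt: "\<forall>j\<in>set js. i < j"
    by simp
  then have "{(a, b) \<in> {i} \<times> set js. b < a} = {}"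
    by fastforce
  then have "inversions {i} (set js) = 0"
    unfolding inversions_def by (simp only: card.empty)
  moreover have "i \<notin> set js"
    using lt by blast
  ultimately show ?case
    using Cons by (simp add: grassmann_gen_def[of i] grassmann_basis_mult grassmann_scale_one)
qed

lemma coord_sum: "coord (sum f I) A = (\<Sum>i\<in>I. coord (f i) A)"
  by (induction I rule: infinite_finite_induct) (auto simp: plus_grassmann.rep_eq zero_grassmann.rep_eq)

lemma coord_grassmann_basis: "finite A \<Longrightarrow> coord (grassmann_basis A) B = (if A = B then 1 else 0)"
  by (simp add: grassmann_basis.rep_eq)

lemma inj_on_grassmann_basis:
  "inj_on (grassmann_basis :: nat set \<Rightarrow> 'k::field grassmann) {A. finite A}"
proof (rule inj_onI)
  fix A B :: "nat set"
  assume "A \<in> {A. finite A}" "B \<in> {A. finite A}"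
    and eq: "(grassmann_basis A :: 'k grassmann) = grassmann_basis B"
  then have "coord (grassmann_basis A :: 'k grassmann) B = 1"
    by (simp add: coord_grassmann_basis)
  with \<open>A \<in> {A. finite A}\<close> show "A = B"
    by (simp add: coord_grassmann_basis split: if_splits)
qed

lemma independent_grassmann_basis:
  "\<not> module.dependent grassmann_scale (grassmann_basis ` {A. finite A})"
proof -
  interpret vector_space "grassmann_scale :: 'a \<Rightarrow> _" by (rule vector_space_grassmann_scale)
  show "independent (grassmann_basis ` {A. finite A})"
    unfolding independent_explicit_module
  proof (intro allI impI)
    fix t :: "'a grassmann set" and u v
    assume t: "finite t" "t \<subseteq> grassmann_basis ` {A. finite A}"
      and sum: "(\<Sum>v\<in>t. grassmann_scale (u v) v) = 0" and v: "v \<in> t"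
    obtain A where A: "finite A" "v = grassmann_basis A"
      using t v by auto
    have "coord (grassmann_scale (u b) b) A = (if b = v then u v else 0)" if b: "b \<in> t" for b
    proof -
      obtain B where "finite B" "b = grassmann_basis B"
        using t b by auto
      then show ?thesis
        using A by (cases "A = B")
          (auto simp: grassmann_scale.rep_eq coord_grassmann_basis
            dest: inj_onD[OF inj_on_grassmann_basis])
    qed
    then have "coord (\<Sum>v\<in>t. grassmann_scale (u v) v) A = (\<Sum>b\<in>t. if b = v then u v else 0)"
      by (simp add: coord_sum)
    then show "u v = 0"
      using t v sum by (simp add: zero_grassmann.rep_eq)
  qed
qed

lemma span_grassmann_basis:
  "module.span grassmann_scale (grassmann_basis ` {A. finite A}) = UNIV"
proof -
  interpret vector_space "grassmann_scale :: 'a \<Rightarrow> _" by (rule vector_space_grassmann_scale)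
  have "a \<in> span (grassmann_basis ` {A. finite A})" for a :: "'a grassmann"
  proof -
    have supp: "finite {A. coord a A \<noteq> 0}" "\<And>A. coord a A \<noteq> 0 \<Longrightarrow> finite A"
      using coord[of a] by auto
    have "a = (\<Sum>A | coord a A \<noteq> 0. grassmann_scale (coord a A) (grassmann_basis A))"
    proof (rule grassmann_eqI)
      fix B :: "nat set"
      have "coord (\<Sum>A | coord a A \<noteq> 0. grassmann_scale (coord a A) (grassmann_basis A)) B =
          (\<Sum>A | coord a A \<noteq> 0. if A = B then coord a B else 0)"
        unfolding coord_sum
        by (intro sum.cong) (auto simp: grassmann_scale.rep_eq coord_grassmann_basis supp(2))
      also have "\<dots> = coord a B"
        using supp(1) by simp
      finally show "coord a B =
          coord (\<Sum>A | coord a A \<noteq> 0. grassmann_scale (coord a A) (grassmann_basis A)) B" ..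
    qed
    moreover have "\<dots> \<in> span (grassmann_basis ` {A. finite A})"
      by (intro span_sum span_scale span_base) (auto simp: supp(2))
    ultimately show ?thesis by (rule ssubst)
  qed
  then show ?thesis by blast
qed

section \<open>The polynomials $w_n$\<close>

definition w_poly :: "nat \<Rightarrow> nat \<Rightarrow> 'k::field free_algebra" where
  "w_poly p n = (\<Prod>k\<leftarrow>[1..<n + 1].
     commutator (var (2 * k - 1)) (var (2 * k)) * var (2 * k - 1) ^ (p - 1) * var (2 * k) ^ (p - 1))"

end

(* Modulo triple commutators the free algebra is the algebra of even polynomial differential forms,
   the class of [a, b] being 2 da db, and a homomorphism to the Grassmann algebra evaluates a form at
   an even and an odd element for each x_i and dx_i. The odd part of the value of a form is the value
   of its differential, so the centrally valued polynomials are the closed forms, whereas the T-space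
   generated by [x_1, x_2] and [x_1, x_2] [x_3, x_4] consists of the exact ones. In characteristic 0
   closed forms are exact up to constants. In characteristic p the Cartier isomorphism leaves
   the products of p-th powers with the forms x_i^(p-1) dx_i, which are the values of x_1^p
   and x_(2n+1)^p w_n. The proof carries this out monomial by monomial: on the forms of a fixed
   multidegree m the differential is multiplication by sum_i m_i dlog x_i. *)
theory Submission
  imports Defs "HOL-Library.Multiset" "HOL-Computational_Algebra.Polynomial"
begin

section \<open>Rings in which commutators are central\<close>

text \<open>Forms serve as a guide only. Spanning is proved in a quotient of the free algebra in
  which commutators are central, independence on values in G. A subspace V of centrally valued
  polynomials that contains the exact ones exhausts them as soon as V and the normal forms of a
  complement span everything and no nontrivial combination of the latter is centrally valued.

  For a multidegree m put \<omega> = sum_i m_i dlog x_i. If \<omega> is nonzero, fix j with m_j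
  nonzero in k: modulo exact forms, dlog x_j can be exchanged for the other dlog x_l, and
  multiplication by \<omega> is injective on forms without dlog x_j. If \<omega> = 0, all forms of
  multidegree m are closed and have to be found in V by hand; this is where the two characteristics
  differ.

  Values are taken at x_i = s_i (1 + e_i), for which dlog x_i becomes e_i. The scalars s_i separate
  the multidegrees, which uses that the field is infinite. An ordered monomial also carries forms of
  higher degree, hence the induction on the size of I in the independence proof.\<close>

lemma commutator_mult_left: "commutator (a * b) c = a * commutator b c + commutator a c * b"
  by (simp add: commutator_def algebra_simps)

lemma commutator_mult_right: "commutator a (b * c) = commutator a b * c + b * commutator a c"
  by (simp add: commutator_def algebra_simps)

lemma commutator_skew: "commutator b a = - commutator a b"
  by (simp add: commutator_def)

lemma commutator_self [simp]: "commutator a a = 0"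
  by (simp add: commutator_def)

lemma commutator_one [simp]: "commutator 1 (a :: 'a::ring_1) = 0"
  by (simp add: commutator_def)

lemma of_nat_left_commute:
  "a * of_nat n = of_nat n * a" "a * (of_nat n * b) = of_nat n * (a * b)" for a b :: "'a::ring_1"
  by (simp_all add: mult_of_nat_commute) (simp flip: mult.assoc mult_of_nat_commute)

text \<open>The value on lists of odd length is chosen so that, when commutators are central, the product
  is alternating on all lists.\<close>

fun comm_prod :: "(nat \<Rightarrow> 'a::ring_1) \<Rightarrow> nat list \<Rightarrow> 'a" where
  "comm_prod x [] = 1"
| "comm_prod x [a] = 0"
| "comm_prod x (a # b # L) = commutator (x a) (x b) * comm_prod x L"

lemma comm_prod_odd: "odd (length L) \<Longrightarrow> comm_prod x L = 0"
  by (induction x L rule: comm_prod.induct) auto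

lemma comm_prod_append2: "comm_prod x (L @ [a, b]) = comm_prod x L * commutator (x a) (x b)"
proof (induction x L rule: comm_prod.induct)
  case (2 x c)
  then show ?case by simp
qed (auto simp: mult.assoc)

definition monom_prod :: "(nat \<Rightarrow> 'a::ring_1) \<Rightarrow> (nat \<Rightarrow> nat) \<Rightarrow> nat \<Rightarrow> 'a" where
  "monom_prod x \<alpha> n = prod_list (map (\<lambda>i. x i ^ \<alpha> i) [0..<n])"

lemma monom_prod_0 [simp]: "monom_prod x \<alpha> 0 = 1"
  by (simp add: monom_prod_def)

lemma monom_prod_Suc: "monom_prod x \<alpha> (Suc n) = monom_prod x \<alpha> n * x n ^ \<alpha> n"
  by (simp add: monom_prod_def)

lemma monom_prod_cong: "(\<And>i. i < n \<Longrightarrow> \<alpha> i = \<beta> i) \<Longrightarrow> monom_prod x \<alpha> n = monom_prod x \<beta> n"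
  unfolding monom_prod_def by (intro arg_cong[where f = prod_list] map_cong) auto

lemma monom_prod_zero: "monom_prod x (\<lambda>_. 0) n = 1"
  by (induction n) (auto simp: monom_prod_Suc)

definition w_prod :: "nat \<Rightarrow> (nat \<Rightarrow> 'a::ring_1) \<Rightarrow> nat \<Rightarrow> 'a" where
  "w_prod p y n = (\<Prod>k\<leftarrow>[1..<n + 1].
     commutator (y (2 * k - 1)) (y (2 * k)) * y (2 * k - 1) ^ (p - 1) * y (2 * k) ^ (p - 1))"

lemma w_prod_0 [simp]: "w_prod p y 0 = 1"
  by (simp add: w_prod_def)

lemma w_prod_Suc: "w_prod p y (Suc n) = w_prod p y n *
    (commutator (y (2 * n + 1)) (y (2 * n + 2)) * y (2 * n + 1) ^ (p - 1) * y (2 * n + 2) ^ (p - 1))"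
  by (simp add: w_prod_def)

text \<open>The head of \<open>ys\<close> is moved to the front of \<open>xs\<close> by adjacent
  swaps, each costing a sign, and the induction continues with
  \<open>\<lambda>zs. f (a # zs)\<close>. The sign is left undetermined, since vanishing and
  membership in a subspace do not depend on it.\<close>

lemma skew_list_perm:
  fixes f :: "'b list \<Rightarrow> 'a::group_add"
  assumes "\<And>us a b vs. f (us @ a # b # vs) = - f (us @ b # a # vs)"
    and "mset xs = mset ys"
  shows "f xs = f ys \<or> f xs = - f ys"
  using assms
proof (induction ys arbitrary: f xs)
  case Nil
  then show ?case by simp
next
  case (Cons a ys)
  then have "a \<in> set xs"
    by (metis list.set_intros(1) set_mset_mset)
  then obtain us vs where xs: "xs = us @ a # vs"
    by (auto simp: in_set_conv_decomp)
  have front: "f (us @ a # vs) = f (a # us @ vs) \<or> f (us @ a # vs) = - f (a # us @ vs)"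
    for us vs
  proof (induction us arbitrary: vs rule: rev_induct)
    case (snoc c us)
    have "f ((us @ [c]) @ a # vs) = - f (us @ a # c # vs)"
      using Cons.prems(1)[of us c a vs] by simp
    then show ?case
      using snoc[of "c # vs"] by (elim disjE) simp_all
  qed simp
  have perm: "mset (us @ vs) = mset ys"
    using Cons.prems(2) xs by simp
  have "f (a # us' @ c # b # vs') = - f (a # us' @ b # c # vs')" for us' c b vs'
    using Cons.prems(1)[of "a # us'" c b vs'] by simp
  then have "f (a # us @ vs) = f (a # ys) \<or> f (a # us @ vs) = - f (a # ys)"
    using perm by (rule Cons.IH[of "\<lambda>zs. f (a # zs)" "us @ vs"])
  then show ?case
    using front[of us vs] unfolding xs by (elim disjE) simp_all
qed

text \<open>The rules shared by the two rings of the proof: the Grassmann algebra, and the quotient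
  of the free algebra by an ideal containing all triple commutators.\<close>

locale lie_nilpotent =
  fixes type :: "'a::ring_1 itself"
  assumes commutator_commutator: "\<And>a b c :: 'a. commutator (commutator a b) c = 0"
    and two_torsion_free: "\<And>a :: 'a. a + a = 0 \<Longrightarrow> a = 0"
begin

lemma commutator_commute: "commutator a b * c = c * commutator a (b::'a)"
  using commutator_commutator[of a b c] by (simp add: commutator_def)

lemma commutator_central: "commutator a b \<in> (center :: 'a set)"
  by (simp add: center_def commutator_commute)

text \<open>Expanding 0 = [[a, bc], d] by the product rules leaves [a, b][c, d] + [b, d][a, c]. In
  terms of forms, db and dc anticommute.\<close>

lemma commutator_swap: "commutator a b * commutator c d = - (commutator a c * commutator b (d::'a))"
proof -
  have "0 = commutator (commutator a (b * c)) d"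
    by (simp add: commutator_commutator)
  also have "\<dots> = commutator (commutator a b * c + b * commutator a c) d"
    by (simp add: commutator_mult_right)
  also have "\<dots> = commutator (commutator a b * c) d + commutator (b * commutator a c) d"
    by (simp add: commutator_def algebra_simps)
  also have "\<dots> = commutator a b * commutator c d + commutator b d * commutator a c"
    by (simp add: commutator_mult_left commutator_commutator)
  finally show ?thesis
    unfolding commutator_commute[of b d] by (metis eq_neg_iff_add_eq_0)
qed

text \<open>With equal middle entries the swap rule reads [b, a][a, c] = - [b, a][a, c]; the
  counterpart of da da = 0.\<close>

lemma commutator_common_1: "commutator a b * commutator a (c::'a) = 0"
proof -
  have "commutator b a * commutator a c = - (commutator b a * commutator a c)"
    by (rule commutator_swap)
  then show ?thesis
    using two_torsion_free[of "commutator b a * commutator a c"]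
    by (simp add: commutator_skew[of b a])
      (metis add.left_inverse)
qed

lemma commutator_common:
  "commutator a b * commutator a (c::'a) = 0" "commutator b a * commutator a (c::'a) = 0"
  "commutator a b * commutator c (a::'a) = 0" "commutator b a * commutator c (a::'a) = 0"
  by (simp_all add: commutator_common_1 commutator_skew[of b a] commutator_skew[of c a])

lemma commutator_power: "commutator (a ^ n) b = of_nat n * a ^ (n - 1) * commutator a (b::'a)"
proof (induction n)
  case (Suc n)
  have "commutator (a ^ Suc n) b = a * commutator (a ^ n) b + commutator a b * a ^ n"
    by (simp add: commutator_mult_left)
  also have "a * commutator (a ^ n) b = of_nat n * a ^ n * commutator a b"
    unfolding Suc.IH by (cases n) (simp_all add: mult.assoc mult_of_nat_commute del: of_nat_Suc)
  finally show ?case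
    by (simp add: commutator_commute[of a b] algebra_simps)
qed simp

lemma comm_prod_commute: "comm_prod x L * c = c * comm_prod x L" for c :: 'a
proof (induction x L rule: comm_prod.induct)
  case (3 x a b L)
  have "commutator (x a) (x b) * comm_prod x L * c = commutator (x a) (x b) * c * comm_prod x L"
    by (simp add: mult.assoc 3)
  then show ?case
    by (simp add: commutator_commute[of "x a" "x b" c] mult.assoc)
qed auto

text \<open>A swap inside a pair is skew symmetry of the commutator, a swap across the border of two
  pairs is \<open>commutator_swap\<close>. If nothing follows the border, both lists have odd length
  and both products are 0.\<close>

lemma comm_prod_swap:
  "comm_prod x (us @ a # b # vs) = - comm_prod x (us @ b # a # vs)" for x :: "nat \<Rightarrow> 'a"
proof (induction x us rule: comm_prod.induct)
  case (1 x)
  then show ?case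
    by (simp add: commutator_skew[of "x b" "x a"])
next
  case (2 x c)
  show ?case
  proof (cases vs)
    case (Cons d vs')
    then show ?thesis
      by (simp add: mult.assoc[symmetric] commutator_swap[of "x c" "x a"])
  qed simp
qed auto

lemma comm_prod_perm:
  assumes "mset L = mset L'"
  shows "comm_prod x L = comm_prod x L' \<or> comm_prod x L = - (comm_prod x L' :: 'a)"
  by (rule skew_list_perm[where f = "comm_prod x", OF comm_prod_swap assms])

lemma comm_prod_not_distinct:
  assumes "\<not> distinct L"
  shows "comm_prod x L = (0 :: 'a)"
proof -
  obtain us vs ws a where L: "L = us @ [a] @ vs @ [a] @ ws"
    using not_distinct_decomp[OF assms] by blast
  have "comm_prod x (a # a # us @ vs @ ws) = 0"
    by simp
  with comm_prod_perm[of L "a # a # us @ vs @ ws" x] show ?thesis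
    by (auto simp: L)
qed

text \<open>The product rule for d(x^\<alpha>): central commutators move to the right end. Where
  \<open>\<alpha> l - 1\<close> is truncated, the coefficient \<open>\<alpha> l\<close> is
  0.\<close>

lemma commutator_monom_prod:
  "commutator (monom_prod x \<alpha> n) c =
    (\<Sum>l<n. of_nat (\<alpha> l) * monom_prod x (\<alpha>(l := \<alpha> l - 1)) n * commutator (x l) (c :: 'a))"
proof (induction n)
  case (Suc n)
  have "commutator (monom_prod x \<alpha> (Suc n)) c =
      monom_prod x \<alpha> n * commutator (x n ^ \<alpha> n) c + commutator (monom_prod x \<alpha> n) c * x n ^ \<alpha> n"
    by (simp add: monom_prod_Suc commutator_mult_left)
  also have "commutator (monom_prod x \<alpha> n) c * x n ^ \<alpha> n =
      (\<Sum>l<n. of_nat (\<alpha> l) * monom_prod x (\<alpha>(l := \<alpha> l - 1)) (Suc n) * commutator (x l) c)"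
    unfolding Suc.IH sum_distrib_right
    by (intro sum.cong refl)
      (auto simp: monom_prod_Suc mult.assoc commutator_commute)
  also have "monom_prod x \<alpha> n * commutator (x n ^ \<alpha> n) c =
      of_nat (\<alpha> n) * monom_prod x (\<alpha>(n := \<alpha> n - 1)) (Suc n) * commutator (x n) c"
  proof -
    have "monom_prod x (\<alpha>(n := \<alpha> n - 1)) n = monom_prod x \<alpha> n"
      by (intro monom_prod_cong) auto
    then show ?thesis
      by (simp add: monom_prod_Suc commutator_power mult.assoc of_nat_left_commute)
  qed
  finally show ?case
    by (simp add: add.commute del: fun_upd_apply)
qed simp

text \<open>A letter appended to an ordered monomial is moved left to its place; each block
  \<open>x l ^ \<alpha> l\<close> that it passes leaves one commutator, which is central and causes
  no further terms.\<close>

lemma monom_prod_mult_var: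
  assumes "i < n"
  shows "monom_prod x \<alpha> n * x i = monom_prod x (\<alpha>(i := Suc (\<alpha> i))) n +
    (\<Sum>l\<in>{i<..<n}. of_nat (\<alpha> l) * monom_prod x (\<alpha>(l := \<alpha> l - 1)) n * commutator (x l) (x i :: 'a))"
  using assms
proof (induction n)
  case (Suc n)
  show ?case
  proof (cases "i = n")
    case True
    have "monom_prod x (\<alpha>(n := Suc (\<alpha> n))) n = monom_prod x \<alpha> n"
      by (intro monom_prod_cong) auto
    moreover have "{n<..<Suc n} = {}"
      by auto
    ultimately show ?thesis
      unfolding True monom_prod_Suc fun_upd_same by (simp add: power_commutes mult.assoc)
  next
    case False
    then have i: "i < n"
      using Suc.prems by simp
    have 1: "monom_prod x (\<alpha>(n := \<alpha> n - 1)) n = monom_prod x \<alpha> n"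
      by (intro monom_prod_cong) auto
    have eq: "{i<..<Suc n} = insert n {i<..<n}"
      using i by auto
    have "monom_prod x \<alpha> (Suc n) * x i =
        monom_prod x \<alpha> n * x i * x n ^ \<alpha> n + monom_prod x \<alpha> n * commutator (x n ^ \<alpha> n) (x i)"
      by (simp add: monom_prod_Suc commutator_def algebra_simps)
    also have "monom_prod x \<alpha> n * commutator (x n ^ \<alpha> n) (x i) =
        of_nat (\<alpha> n) * monom_prod x (\<alpha>(n := \<alpha> n - 1)) (Suc n) * commutator (x n) (x i)"
      unfolding monom_prod_Suc 1 commutator_power by (simp add: mult.assoc of_nat_left_commute)
    also have "monom_prod x \<alpha> n * x i * x n ^ \<alpha> n = monom_prod x (\<alpha>(i := Suc (\<alpha> i))) (Suc n) +
      (\<Sum>l\<in>{i<..<n}. of_nat (\<alpha> l) * monom_prod x (\<alpha>(l := \<alpha> l - 1)) (Suc n) * commutator (x l) (x i))"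
      unfolding Suc.IH[OF i] distrib_right sum_distrib_right using i
      by (intro arg_cong2[where f = "(+)"] sum.cong refl)
        (auto simp: monom_prod_Suc mult.assoc commutator_commute)
    finally show ?thesis
      by (simp add: eq add.assoc add.left_commute add.commute del: fun_upd_apply)
  qed
qed simp

text \<open>The correction is linear in [u, v] because [u, v] squares to 0. Moving \<open>u\<close>
  past \<open>v ^ n\<close> contributes n in each step, and these add up to n choose 2.\<close>

lemma mult_power:
  "(u * v) ^ n = u ^ n * v ^ n - of_nat (n choose 2) * u ^ (n - 1) * v ^ (n - 1) * commutator u (v :: 'a)"
proof (induction n)
  case (Suc n)
  define c where "c = commutator u v"
  have cc: "c * y = y * c" for y
    by (simp add: c_def commutator_commute)
  have c0: "c * c = 0"
    by (simp add: c_def commutator_common)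
  have vu: "v ^ k * u = u * v ^ k - of_nat k * v ^ (k - 1) * c" for k
    using commutator_power[of v k u] by (simp add: c_def commutator_skew[of v u] commutator_def algebra_simps)
  have A: "u ^ n * v ^ n * (u * v) = u ^ Suc n * v ^ Suc n - of_nat n * u ^ n * v ^ n * c"
  proof -
    have "u ^ n * v ^ n * (u * v) = u ^ n * (v ^ n * u) * v"
      by (simp add: mult.assoc)
    also have "\<dots> = u ^ n * u * (v ^ n * v) - u ^ n * of_nat n * (v ^ (n - 1) * v) * c"
      unfolding vu by (simp add: algebra_simps cc[of v])
    also have "u ^ n * of_nat n * (v ^ (n - 1) * v) * c = of_nat n * u ^ n * v ^ n * c"
      by (cases n) (simp_all add: power_commutes of_nat_left_commute mult.assoc del: of_nat_Suc)
    also have "u ^ n * u * (v ^ n * v) = u ^ Suc n * v ^ Suc n"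
      by (simp add: power_commutes)
    finally show ?thesis .
  qed
  have B: "of_nat (n choose 2) * u ^ (n - 1) * v ^ (n - 1) * c * (u * v) =
      of_nat (n choose 2) * u ^ n * v ^ n * c"
  proof (cases n)
    case (Suc m)
    have "u ^ m * v ^ m * c * (u * v) = u ^ m * (v ^ m * u) * v * c"
      by (simp add: mult.assoc cc)
    also have "\<dots> = u ^ m * u * (v ^ m * v) * c - u ^ m * of_nat m * v ^ (m - 1) * v * (c * c)"
      unfolding vu by (simp add: algebra_simps cc[of v])
    finally show ?thesis
      by (simp add: Suc c0 power_commutes mult.assoc)
  qed (simp add: numeral_2_eq_2)
  have "(u * v) ^ Suc n = u ^ n * v ^ n * (u * v) -
      of_nat (n choose 2) * u ^ (n - 1) * v ^ (n - 1) * c * (u * v)"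
    by (simp add: power_Suc2 Suc.IH left_diff_distrib c_def del: power_Suc)
  also have "\<dots> = u ^ Suc n * v ^ Suc n - of_nat (Suc n choose 2) * u ^ n * v ^ n * c"
    unfolding A B by (simp add: numeral_2_eq_2 algebra_simps)
  finally show ?case
    by (simp add: c_def)
qed (simp add: numeral_2_eq_2)

section \<open>Closed forms in characteristic p: p-th powers and the products w_n\<close>

lemma power_center: "of_nat n = (0 :: 'a) \<Longrightarrow> a ^ n \<in> (center :: 'a set)"
  using commutator_power[of a n] by (simp add: center_def commutator_def)

lemma one_center: "1 \<in> (center :: 'a set)"
  by (simp add: center_def)

lemma mult_center: "a \<in> center \<Longrightarrow> b \<in> center \<Longrightarrow> a * b \<in> (center :: 'a set)"
  unfolding center_def mem_Collect_eq by (metis mult.assoc)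

text \<open>A commutator of a power of \<open>a\<close> or \<open>b\<close> with \<open>c\<close>
  has the factor [a, c] or [b, c], which [a, b] annihilates. In terms of forms, a^q b^r da db is
  closed.\<close>

lemma w_factor_center: "commutator a b * a ^ q * b ^ r \<in> (center :: 'a set)"
proof -
  have "commutator (commutator a b * a ^ q * b ^ r) c = 0" for c
  proof -
    have 1: "commutator a b * commutator (a ^ q) c = 0" "commutator a b * commutator (b ^ r) c = 0"
      unfolding commutator_power commutator_commute[of a b] mult.assoc
      by (simp_all add: commutator_common)
    have "commutator (commutator a b * a ^ q * b ^ r) c =
        commutator a b * a ^ q * commutator (b ^ r) c + commutator a b * commutator (a ^ q) c * b ^ r"
      by (simp add: commutator_mult_left commutator_commutator)
    also have "\<dots> = a ^ q * (commutator a b * commutator (b ^ r) c)"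
      by (simp add: 1(1) commutator_commute[of a b "a ^ q"] mult.assoc)
    finally show ?thesis
      by (simp add: 1(2))
  qed
  then show ?thesis
    by (simp add: center_def commutator_def)
qed

lemma w_prod_center: "w_prod p y n \<in> (center :: 'a set)"
  by (induction n) (simp_all add: w_prod_Suc one_center mult_center w_factor_center)

text \<open>An odd p divides p choose 2, so the correction in \<open>mult_power\<close> vanishes and
  taking p-th powers is multiplicative.\<close>

lemma monom_prod_power:
  fixes x :: "nat \<Rightarrow> 'a"
  assumes "of_nat p = (0 :: 'a)" "odd p"
  shows "monom_prod x \<beta> n ^ p = monom_prod x (\<lambda>i. p * \<beta> i) n"
proof (induction n)
  case (Suc n)
  have "p choose 2 = p * ((p - 1) div 2)"
    using \<open>odd p\<close> by (auto elim!: oddE simp: choose_two)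
  then have "of_nat (p choose 2) = (0 :: 'a)"
    by (simp add: assms(1))
  then show ?case
    by (simp add: monom_prod_Suc mult_power Suc.IH power_mult[symmetric] mult.commute)
qed simp

text \<open>Sorting \<open>x i\<close> into the monomial produces commutators [x_l, x_i], and these
  are annihilated by the factor [x_i, c].\<close>

lemma monom_prod_mult_power:
  assumes "i < n"
  shows "monom_prod x \<gamma> n * x i ^ k * commutator (x i) c =
    monom_prod x (\<gamma>(i := \<gamma> i + k)) n * commutator (x i) (c :: 'a)"
proof (induction k arbitrary: \<gamma>)
  case (Suc k)
  have "monom_prod x \<gamma> n * x i * commutator (x i) c =
      monom_prod x (\<gamma>(i := Suc (\<gamma> i))) n * commutator (x i) c"
    unfolding monom_prod_mult_var[OF assms] distrib_right sum_distrib_right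
    by (simp add: mult.assoc commutator_common)
  then have "monom_prod x \<gamma> n * x i ^ Suc k * commutator (x i) c =
      monom_prod x (\<gamma>(i := Suc (\<gamma> i))) n * x i ^ k * commutator (x i) c"
    by (simp add: mult.assoc commutator_commute[of "x i" c, symmetric])
      (simp flip: mult.assoc)
  then show ?case
    unfolding Suc.IH by (simp del: fun_upd_apply add: fun_upd_upd) (simp add: fun_upd_def)
qed simp

text \<open>Next to the commutators of w_r the powers \<open>p - 1\<close> can be sorted into the
  ordered monomial without corrections. This identifies the substitution instances of x_(2r+1)^p w_r
  with normal forms.\<close>

lemma monom_prod_w_prod:
  fixes x :: "nat \<Rightarrow> 'a"
  assumes "\<forall>i \<in> {1..2 * r}. z i < n"
  shows "monom_prod x \<gamma> n * w_prod p (x \<circ> z) r =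
    monom_prod x (\<lambda>i. \<gamma> i + (p - 1) * count_list (map z [1..<2 * r + 1]) i) n *
    comm_prod x (map z [1..<2 * r + 1])"
  using assms
proof (induction r)
  case (Suc r)
  define a b where ab: "a = z (2 * r + 1)" "b = z (2 * r + 2)"
  define C where "C = commutator (x a) (x b)"
  define L where "L = map z [1..<2 * r + 1]"
  define \<gamma>' where "\<gamma>' = (\<lambda>i. \<gamma> i + (p - 1) * count_list L i)"
  have Cc: "C * y = y * C" for y
    by (simp add: C_def commutator_commute)
  have n: "a < n" "b < n"
    using Suc.prems by (auto simp: ab)
  have L': "map z [1..<2 * Suc r + 1] = L @ [a, b]"
    by (simp add: L_def ab)
  have IH: "monom_prod x \<gamma> n * w_prod p (x \<circ> z) r = monom_prod x \<gamma>' n * comm_prod x L"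
    unfolding L_def \<gamma>'_def by (rule Suc.IH) (use Suc.prems in auto)
  have "monom_prod x \<gamma> n * w_prod p (x \<circ> z) (Suc r) =
      monom_prod x \<gamma>' n * comm_prod x L * (C * x a ^ (p - 1) * x b ^ (p - 1))"
    by (simp add: w_prod_Suc IH[symmetric] ab C_def mult.assoc)
  also have "\<dots> = monom_prod x \<gamma>' n * x a ^ (p - 1) * C * x b ^ (p - 1) * comm_prod x L"
  proof -
    have "comm_prod x L * (C * x a ^ (p - 1) * x b ^ (p - 1)) =
        x a ^ (p - 1) * C * x b ^ (p - 1) * comm_prod x L"
      unfolding Cc[of "x a ^ (p - 1)"] by (rule comm_prod_commute)
    then show ?thesis
      by (simp add: mult.assoc)
  qed
  also have "monom_prod x \<gamma>' n * x a ^ (p - 1) * C = monom_prod x (\<gamma>'(a := \<gamma>' a + (p - 1))) n * C"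
    unfolding C_def by (rule monom_prod_mult_power[OF n(1)])
  \<comment> \<open>The commutator is reversed because \<open>monom_prod_mult_power\<close> expects
    \<open>x b\<close> in its first entry; the sign is undone when it is reversed back.\<close>
  also have "\<dots> * x b ^ (p - 1) =
      - (monom_prod x (\<gamma>'(a := \<gamma>' a + (p - 1))) n * x b ^ (p - 1) * commutator (x b) (x a))"
    unfolding mult.assoc Cc[of "x b ^ (p - 1)"]
    unfolding C_def commutator_skew[of "x b"] by simp
  also have "\<dots> = - (monom_prod x ((\<gamma>'(a := \<gamma>' a + (p - 1)))
        (b := (\<gamma>'(a := \<gamma>' a + (p - 1))) b + (p - 1))) n * commutator (x b) (x a))"
    by (simp only: monom_prod_mult_power[OF n(2)])
  also have "\<dots> * comm_prod x L = monom_prod x ((\<gamma>'(a := \<gamma>' a + (p - 1)))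
        (b := (\<gamma>'(a := \<gamma>' a + (p - 1))) b + (p - 1))) n * comm_prod x (L @ [a, b])"
    by (simp add: comm_prod_append2 comm_prod_commute[of x L "commutator (x a) (x b)"]
        commutator_skew[of "x b"] mult.assoc)
  also have "(\<gamma>'(a := \<gamma>' a + (p - 1))) (b := (\<gamma>'(a := \<gamma>' a + (p - 1))) b + (p - 1)) =
      (\<lambda>i. \<gamma> i + (p - 1) * count_list (L @ [a, b]) i)"
    by (auto simp: \<gamma>'_def fun_eq_iff algebra_simps)
  finally show ?case
    unfolding L' .
qed simp

end

section \<open>Homomorphisms of the free algebra\<close>

lemma alg_homD:
  assumes "alg_hom s1 s2 \<phi>"
  shows "\<phi> (a + b) = \<phi> a + \<phi> b" "\<phi> (s1 c a) = s2 c (\<phi> a)" "\<phi> 1 = 1" "\<phi> (a * b) = \<phi> a * \<phi> b"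
    "\<phi> 0 = 0" "\<phi> (- a) = - \<phi> a" "\<phi> (a - b) = \<phi> a - \<phi> b"
    "\<phi> (commutator a b) = commutator (\<phi> a) (\<phi> b)" "\<phi> (a ^ n) = \<phi> a ^ n"
proof -
  interpret Vector_Spaces.linear s1 s2 \<phi>
    using assms by (simp add: alg_hom_def)
  show 1: "\<phi> (a + b) = \<phi> a + \<phi> b" "\<phi> (s1 c a) = s2 c (\<phi> a)" "\<phi> 1 = 1" "\<phi> (a * b) = \<phi> a * \<phi> b"
      "\<phi> 0 = 0" "\<phi> (- a) = - \<phi> a" "\<phi> (a - b) = \<phi> a - \<phi> b" for a b c
    using assms by (auto simp: alg_hom_def add scale zero neg diff)
  show "\<phi> (commutator a b) = commutator (\<phi> a) (\<phi> b)"
    by (simp add: commutator_def 1)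
  show "\<phi> (a ^ n) = \<phi> a ^ n"
    by (induction n) (simp_all add: 1)
qed

lemma alg_hom_sum:
  assumes "alg_hom s1 s2 \<phi>"
  shows "\<phi> (sum f I) = (\<Sum>i\<in>I. \<phi> (f i))"
  by (induction I rule: infinite_finite_induct) (simp_all add: alg_homD[OF assms])

lemma alg_hom_prod_list:
  assumes "alg_hom s1 s2 \<phi>"
  shows "\<phi> (prod_list xs) = prod_list (map \<phi> xs)"
  by (induction xs) (simp_all add: alg_homD[OF assms])

lemma alg_hom_of_nat:
  assumes "alg_hom s1 s2 \<phi>"
  shows "\<phi> (of_nat n) = of_nat n"
  by (induction n) (simp_all add: alg_homD[OF assms])

lemma alg_hom_compose:
  assumes "alg_hom s1 s2 \<phi>" "alg_hom s2 s3 \<psi>"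
  shows "alg_hom s1 s3 (\<psi> \<circ> \<phi>)"
  using assms unfolding alg_hom_def Vector_Spaces.linear_iff by simp

lemma alg_hom_monom_prod:
  assumes "alg_hom s1 s2 \<phi>"
  shows "\<phi> (monom_prod x \<alpha> n) = monom_prod (\<phi> \<circ> x) \<alpha> n"
  unfolding monom_prod_def by (simp add: alg_hom_prod_list[OF assms] alg_homD[OF assms] o_def)

lemma alg_hom_comm_prod:
  assumes "alg_hom s1 s2 \<phi>"
  shows "\<phi> (comm_prod x L) = comm_prod (\<phi> \<circ> x) L"
  by (induction x L rule: comm_prod.induct) (simp_all add: alg_homD[OF assms])

lemma alg_hom_w_prod:
  assumes "alg_hom s1 s2 \<phi>"
  shows "\<phi> (w_prod p y n) = w_prod p (\<phi> \<circ> y) n"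
  by (induction n) (simp_all add: w_prod_Suc alg_homD[OF assms])

text \<open>Numbering from 0 fits the range \<open>[0..<n]\<close> of \<open>monom_prod\<close> and
  makes all letters distinct, whereas \<open>var 0\<close> and \<open>var 1\<close>
  coincide.\<close>

definition letter :: "nat \<Rightarrow> 'k::field free_algebra" where
  "letter i = Poly_Mapping.single (Word [i]) 1"

lemma var_letter: "var i = letter (i - 1)"
  by (simp add: var_def letter_def)

lemma w_poly_w_prod: "w_poly p n = w_prod p var n"
  by (simp add: w_poly_def w_prod_def)

lemma poly_mapping_sum_single:
  fixes f :: "'b \<Rightarrow>\<^sub>0 'a::comm_monoid_add"
  shows "f = (\<Sum>w\<in>Poly_Mapping.keys f. Poly_Mapping.single w (Poly_Mapping.lookup f w))"
proof (rule poly_mapping_eqI)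
  fix u
  show "Poly_Mapping.lookup f u = Poly_Mapping.lookup
      (\<Sum>w\<in>Poly_Mapping.keys f. Poly_Mapping.single w (Poly_Mapping.lookup f w)) u"
    by (simp add: lookup_sum lookup_single when_def in_keys_iff)
qed

lemma poly_mapping_induct_single [case_names zero single add]:
  fixes f :: "'b \<Rightarrow>\<^sub>0 'a::comm_monoid_add"
  assumes "P 0" "\<And>w c. P (Poly_Mapping.single w c)" "\<And>f g. P f \<Longrightarrow> P g \<Longrightarrow> P (f + g)"
  shows "P f"
proof -
  have "P (\<Sum>w\<in>W. Poly_Mapping.single w (Poly_Mapping.lookup f w))" for W
    by (induction W rule: infinite_finite_induct) (simp_all add: assms)
  then show ?thesis
    by (subst poly_mapping_sum_single)
qed

definition algebra_scale :: "('k::field \<Rightarrow> 'a::ring_1 \<Rightarrow> 'a) \<Rightarrow> bool" where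
  "algebra_scale s \<longleftrightarrow> vector_space s \<and>
     (\<forall>c a b. s c (a * b) = s c a * b \<and> s c (a * b) = a * s c b)"

lemma algebra_scale_grassmann: "algebra_scale grassmann_scale"
  unfolding algebra_scale_def using vector_space_grassmann_scale grassmann_scale_mult by blast

lemma algebra_scale_free: "algebra_scale free_scale"
proof -
  have comm: "Poly_Mapping.single 0 c * f = f * Poly_Mapping.single 0 c" for c :: "'k::field" and f
    by (induction f rule: poly_mapping_induct_single) (simp_all add: mult_single algebra_simps)
  have "free_scale c (a * b) = a * free_scale c b" for c :: "'k::field" and a b
    unfolding free_scale_conv_mult by (metis comm mult.assoc)
  then show ?thesis
    by (auto simp: algebra_scale_def vector_space_free_scale free_scale_conv_mult mult.assoc)
qed

lemma free_algebra_hom_exists: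
  fixes x :: "nat \<Rightarrow> 'a::ring_1" and s :: "'k::field \<Rightarrow> 'a \<Rightarrow> 'a"
  assumes "algebra_scale s"
  obtains \<phi> where "alg_hom free_scale s \<phi>" "\<And>i. \<phi> (letter i) = x i"
proof -
  interpret vector_space s
    using assms by (simp add: algebra_scale_def)
  have s_mult: "s c a * b = s c (a * b)" "a * s c b = s c (a * b)" for a b c
    using assms unfolding algebra_scale_def by metis+
  define m where "m w = prod_list (map x (letters w))" for w
  define \<phi> where "\<phi> f = (\<Sum>w\<in>Poly_Mapping.keys f. s (Poly_Mapping.lookup f w) (m w))"
    for f :: "'k free_algebra"
  have add: "\<phi> (f + g) = \<phi> f + \<phi> g" for f g
    unfolding \<phi>_def by (rule setsum_keys_plus_distrib) (simp_all add: scale_left_distrib)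
  have \<phi>_single: "\<phi> (Poly_Mapping.single w c) = s c (m w)" for w c
    by (simp add: \<phi>_def)
  have zero: "\<phi> 0 = 0"
    by (simp add: \<phi>_def)
  have m_add: "m (u + v) = m u * m v" for u v
    by (simp add: m_def plus_word_def)
  have m_0: "m 0 = 1"
    by (simp add: m_def zero_word_def)
  have mult: "\<phi> (f * g) = \<phi> f * \<phi> g" for f g
  proof (induction f rule: poly_mapping_induct_single)
    case (single u c)
    show ?case
      by (induction g rule: poly_mapping_induct_single)
        (simp_all add: \<phi>_single mult_single m_add s_mult zero add distrib_left mult.commute)
  qed (simp_all add: zero add distrib_right)
  have one: "\<phi> 1 = 1"
    by (simp add: \<phi>_single m_0 flip: single_one)
  have scale: "\<phi> (free_scale c f) = s c (\<phi> f)" for c f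
    unfolding free_scale_conv_mult mult by (simp add: \<phi>_single m_0 s_mult)
  have "alg_hom free_scale s \<phi>"
    unfolding alg_hom_def Vector_Spaces.linear_iff
    using vector_space_free_scale vector_space_axioms by (auto simp: add scale one mult)
  moreover have "\<phi> (letter i) = x i" for i
    by (simp add: letter_def \<phi>_single m_def)
  ultimately show ?thesis
    using that by blast
qed

lemma augmentation_mult:
  "Poly_Mapping.lookup (f * g) 0 = Poly_Mapping.lookup f 0 * Poly_Mapping.lookup g 0"
  for f g :: "'k::field free_algebra"
proof (induction f rule: poly_mapping_induct_single)
  case (single u c)
  show ?case
    by (induction g rule: poly_mapping_induct_single)
      (auto simp: mult_single lookup_single when_def lookup_add distrib_left zero_word_def
        plus_word_def word.expand)
qed (simp_all add: lookup_add distrib_right)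

section \<open>The Grassmann algebra\<close>

text \<open>Each pair in A \<times> B has distinct entries and is an inversion for exactly one of
  the two orders.\<close>

lemma inversions_swap:
  assumes "finite A" "finite B" "A \<inter> B = {}"
  shows "inversions A B + inversions B A = card A * card B"
proof -
  define S where "S = {(a, b) \<in> A \<times> B. b < a}"
  define T where "T = {(a, b) \<in> A \<times> B. a < b}"
  have fin: "finite S" "finite T"
    unfolding S_def T_def by (rule finite_subset[of _ "A \<times> B"]; use assms in auto)+
  have "{(b, a) \<in> B \<times> A. a < b} = prod.swap ` T"
    by (auto simp: T_def)
  then have "inversions B A = card T"
    unfolding inversions_def by (simp add: card_image)
  moreover have "inversions A B = card S"
    by (simp add: inversions_def S_def)
  moreover have "card (S \<union> T) = card S + card T"
    using fin by (intro card_Un_disjoint) (auto simp: S_def T_def)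
  moreover have "S \<union> T = A \<times> B"
  proof -
    have "a \<noteq> b" if "a \<in> A" "b \<in> B" for a b
      using that assms(3) by blast
    then show ?thesis
      unfolding S_def T_def using linorder_neqE_nat by fastforce
  qed
  ultimately show ?thesis
    by (simp add: card_cartesian_product)
qed

lemma coord_mult_flip:
  fixes a b :: "'k::field grassmann"
  assumes "finite C"
  shows "coord (b * a) C = (\<Sum>A\<in>Pow C. (-1) ^ inversions (C - A) A * coord a A * coord b (C - A))"
  unfolding times_grassmann.rep_eq
  by (rule sum.reindex_bij_witness[of _ "\<lambda>A. C - A" "\<lambda>A. C - A"])
    (auto simp: double_diff mult.commute mult.left_commute)

lemma sign_swap:
  assumes "finite C" "A \<subseteq> C"
  shows "(- 1 :: 'k::field) ^ inversions A (C - A) =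
    (- 1) ^ (card A * card (C - A)) * (- 1) ^ inversions (C - A) A"
proof -
  have "inversions A (C - A) + inversions (C - A) A = card A * card (C - A)"
    using assms by (intro inversions_swap) (auto intro: finite_subset)
  then have "(- 1 :: 'k) ^ (card A * card (C - A)) =
      (- 1) ^ inversions A (C - A) * (- 1) ^ inversions (C - A) A"
    by (metis power_add)
  then show ?thesis
    by (simp add: mult.assoc flip: power_mult_distrib)
qed

lift_definition even_part :: "'k::field grassmann \<Rightarrow> 'k grassmann"
  is "\<lambda>f A. if even (card A) then f A else 0"
  by (auto intro: finite_subset)

lift_definition odd_part :: "'k::field grassmann \<Rightarrow> 'k grassmann"
  is "\<lambda>f A. if odd (card A) then f A else 0"
  by (auto intro: finite_subset)

lemma even_part_plus_odd_part: "even_part a + odd_part a = a"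
  by transfer auto

lemma even_commute:
  assumes "\<And>A. odd (card A) \<Longrightarrow> coord a A = 0"
  shows "a * b = b * (a :: 'k::field grassmann)"
proof (rule grassmann_eqI)
  fix C :: "nat set" assume C: "finite C"
  show "coord (a * b) C = coord (b * a) C"
    unfolding coord_mult_flip[OF C, where a = a and b = b]
    unfolding times_grassmann.rep_eq
  proof (rule sum.cong)
    fix A assume "A \<in> Pow C"
    then show "(- 1) ^ inversions A (C - A) * coord a A * coord b (C - A) =
        (- 1) ^ inversions (C - A) A * coord a A * coord b (C - A)"
      using assms[of A] by (cases "even (card A)") (simp_all add: sign_swap[OF C, of A])
  qed simp
qed

lemma odd_anticommute:
  "odd_part a * odd_part b = - (odd_part b * odd_part (a :: 'k::field grassmann))"
proof (rule grassmann_eqI)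
  fix C :: "nat set" assume C: "finite C"
  show "coord (odd_part a * odd_part b) C = coord (- (odd_part b * odd_part a)) C"
    unfolding uminus_grassmann.rep_eq coord_mult_flip[OF C, where b = "odd_part b" and a = "odd_part a"]
    unfolding times_grassmann.rep_eq sum_negf[symmetric]
  proof (rule sum.cong)
    fix A assume "A \<in> Pow C"
    then show "(- 1) ^ inversions A (C - A) * coord (odd_part a) A * coord (odd_part b) (C - A) =
        - ((- 1) ^ inversions (C - A) A * coord (odd_part a) A * coord (odd_part b) (C - A))"
      by (cases "odd (card A) \<and> odd (card (C - A))")
        (auto simp: sign_swap[OF C, of A] odd_part.rep_eq)
  qed simp
qed

lemma coord_odd_part_mult:
  assumes "odd (card C)"
  shows "coord (odd_part a * odd_part b) C = 0"
proof -
  have C: "finite C"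
    using assms by (metis card.infinite even_zero)
  have "card C = card A + card (C - A)" if "A \<subseteq> C" for A
    using C that by (metis card_Diff_subset card_mono finite_subset le_add_diff_inverse)
  then show ?thesis
    unfolding times_grassmann.rep_eq using assms
    by (intro sum.neutral) (auto simp: odd_part.rep_eq)
qed

text \<open>Even parts are central and odd parts anticommute, so only twice the product of the odd
  parts survives: the counterpart of [a, b] = 2 da db.\<close>

lemma grassmann_commutator:
  "commutator a b = odd_part a * odd_part b + odd_part a * odd_part (b :: 'k::field grassmann)"
proof -
  have 1: "even_part c * d = d * even_part c" for c d :: "'k grassmann"
    by (rule even_commute) (simp add: even_part.rep_eq)
  have "commutator a b = commutator (even_part a + odd_part a) (even_part b + odd_part b)"
    by (simp add: even_part_plus_odd_part)
  also have "\<dots> = odd_part a * odd_part b - odd_part b * odd_part a"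
    by (simp add: commutator_def algebra_simps 1[of a "odd_part b"] 1[of b "odd_part a"]
        1[of a "even_part b"])
  also have "\<dots> = odd_part a * odd_part b + odd_part a * odd_part b"
    by (simp add: odd_anticommute[of b a])
  finally show ?thesis .
qed

lemma lie_nilpotent_grassmann:
  assumes "(2 :: 'k::field) \<noteq> 0"
  shows "lie_nilpotent TYPE('k grassmann)"
proof
  fix a b c :: "'k grassmann"
  have "commutator a b * c = c * commutator a b"
    by (rule even_commute)
      (simp add: grassmann_commutator plus_grassmann.rep_eq coord_odd_part_mult)
  then show "commutator (commutator a b) c = 0"
    by (simp add: commutator_def)
next
  fix a :: "'k grassmann"
  assume "a + a = 0"
  then have "coord (a + a) A = 0" for A
    by (simp add: zero_grassmann.rep_eq)
  then have "2 * coord a A = 0" for A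
    by (simp add: plus_grassmann.rep_eq)
  then show "a = 0"
    using assms by (intro grassmann_eqI) (simp add: zero_grassmann.rep_eq)
qed

section \<open>Odd coordinates of central elements, and values at 1 + e_i\<close>

lemma coord_mult_basis:
  fixes g :: "'k::field grassmann"
  assumes "finite B" "finite I"
  shows "coord (g * grassmann_basis I) B =
    (if I \<subseteq> B then (-1) ^ inversions (B - I) I * coord g (B - I) else 0)"
proof -
  have "coord (g * grassmann_basis I) B =
      (\<Sum>A\<in>Pow B. if A = B - I then (if I \<subseteq> B then (-1) ^ inversions (B - I) I * coord g (B - I) else 0) else 0)"
    unfolding times_grassmann.rep_eq
    by (intro sum.cong) (auto simp: coord_grassmann_basis assms double_diff)
  then show ?thesis
    using assms by (simp add: sum.delta)
qed

lemma coord_basis_mult: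
  fixes g :: "'k::field grassmann"
  assumes "finite B" "finite I"
  shows "coord (grassmann_basis I * g) B =
    (if I \<subseteq> B then (-1) ^ inversions I (B - I) * coord g (B - I) else 0)"
proof -
  have "coord (grassmann_basis I * g) B =
      (\<Sum>A\<in>Pow B. if A = I then (-1) ^ inversions I (B - I) * coord g (B - I) else 0)"
    unfolding times_grassmann.rep_eq
    by (intro sum.cong) (auto simp: coord_grassmann_basis assms)
  then show ?thesis
    using assms by (simp add: sum.delta)
qed

text \<open>There is always a generator e_q not involved in e_B, and e_B e_q = - e_q e_B for odd B.
  Comparing z e_q with e_q z at B \<union> {q} shows that the coordinate of z at B is its own
  negative.\<close>

lemma center_coord_odd:
  fixes z :: "'k::field grassmann"
  assumes "(2 :: 'k) \<noteq> 0" "z \<in> center" "odd (card B)"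
  shows "coord z B = 0"
proof -
  have B: "finite B"
    using assms(3) by (metis card.infinite even_zero)
  \<comment> \<open>Choosing q above all of B makes the numbers of inversions explicit: none in one
    order, \<open>card B\<close> in the other.\<close>
  obtain q where q: "\<forall>b\<in>B. b < q"
    using finite_nat_set_iff_bounded B by blast
  then have d: "insert q B - {q} = B" "q \<notin> B"
    by auto
  have 0: "{(a, b) \<in> B \<times> {q}. b < a} = {}" and 1: "{(a, b) \<in> {q} \<times> B. b < a} = {q} \<times> B"
    using q by auto
  have i: "inversions B {q} = 0" "inversions {q} B = card B"
    unfolding inversions_def 0 1 by (simp_all add: card_cartesian_product)
  have "coord (z * grassmann_basis {q}) (insert q B) = coord (grassmann_basis {q} * z) (insert q B)"
    using assms(2) by (simp add: center_def)
  then have "coord z B = - coord z B"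
    using B assms(3) by (simp add: coord_mult_basis coord_basis_mult d i)
  then have "2 * coord z B = 0"
    by (simp add: eq_neg_iff_add_eq_0)
  then show ?thesis
    using assms(1) by simp
qed

lemma coord_empty_mult: "coord (a * b) {} = coord a {} * coord b {}"
  by (simp add: times_grassmann.rep_eq)

lemma coord_singleton_mult:
  "coord (a * b) {j} = coord a {} * coord b {j} + coord a {j} * coord b {}"
proof -
  have "Pow {j} = {{}, {j}}"
    by auto
  then show ?thesis
    by (simp add: times_grassmann.rep_eq)
qed

lemma coord_one_plus_gen:
  "coord (1 + grassmann_gen i) {} = 1"
  "coord (1 + grassmann_gen i) {j} = (if i = j then 1 else 0)"
  by (simp_all add: plus_grassmann.rep_eq one_grassmann.rep_eq grassmann_gen_def
      coord_grassmann_basis)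

lemma coord_one_plus_gen_power:
  "coord ((1 + grassmann_gen i) ^ r) {} = (1 :: 'k::field) \<and>
   coord ((1 + grassmann_gen i :: 'k grassmann) ^ r) {j} = (if i = j then of_nat r else 0)"
  by (induction r)
    (simp_all add: coord_empty_mult coord_singleton_mult coord_one_plus_gen one_grassmann.rep_eq)

text \<open>At x_i = 1 + e_i the part of degree one of x^\<alpha> is its logarithmic derivative, so
  the coordinate at {j} reads off the exponent of x_j as an element of k.\<close>

lemma coord_monom_prod_one_plus_gen:
  "coord (monom_prod (\<lambda>i. 1 + grassmann_gen i) \<alpha> n) {} = (1 :: 'k::field) \<and>
   coord (monom_prod (\<lambda>i. 1 + grassmann_gen i :: 'k grassmann) \<alpha> n) {j} = (if j < n then of_nat (\<alpha> j) else 0)"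
  by (induction n)
    (auto simp: less_Suc_eq coord_empty_mult coord_singleton_mult monom_prod_Suc coord_one_plus_gen_power
      one_grassmann.rep_eq)

lemma comm_prod_one_plus_gen:
  assumes "even (length L)"
  shows "comm_prod (\<lambda>i. 1 + grassmann_gen i :: 'k::field grassmann) L =
    grassmann_scale (2 ^ (length L div 2)) (prod_list (map grassmann_gen L))"
  using assms
proof (induction "\<lambda>i. 1 + grassmann_gen i :: 'k grassmann" L rule: comm_prod.induct)
  case 1
  then show ?case by (simp add: grassmann_scale_one)
next
  case (3 a b L)
  interpret vector_space "grassmann_scale :: 'k \<Rightarrow> _"
    by (rule vector_space_grassmann_scale)
  have "commutator (1 + grassmann_gen a) (1 + grassmann_gen b) =
      grassmann_gen a * grassmann_gen b - grassmann_gen b * (grassmann_gen a :: 'k grassmann)"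
    by (simp add: commutator_def algebra_simps)
  also have "\<dots> = grassmann_gen a * grassmann_gen b + grassmann_gen a * grassmann_gen b"
    by (simp add: grassmann_gen_anticommute[of b a])
  also have "\<dots> = grassmann_scale 2 (grassmann_gen a * grassmann_gen b)"
    by (simp add: scale_left_distrib[of 1 1, simplified] grassmann_scale_one)
  finally show ?case
    using 3 by (simp add: grassmann_scale_mult[symmetric] mult.assoc)
qed simp

section \<open>The T-space generated by the commutators and their products\<close>

interpretation free: vector_space "free_scale :: 'k::field \<Rightarrow> _"
  by (rule vector_space_free_scale)

lemma of_nat_mult_free: "of_nat c * f = free_scale (of_nat c) (f :: 'k::field free_algebra)"
  by (simp add: free_scale_conv_mult)

lemma T_space_gen_subset: "Y \<subseteq> V \<Longrightarrow> T_space V \<Longrightarrow> T_space_gen Y \<subseteq> V"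
  unfolding T_space_gen_def by (rule hull_minimal)

lemma T_space_gen_base: "y \<in> Y \<Longrightarrow> y \<in> T_space_gen Y"
  unfolding T_space_gen_def by (rule hull_inc)

lemma T_space_subspace: "T_space V \<Longrightarrow> free.subspace V"
  by (simp add: T_space_def)

lemma T_space_hom: "T_space V \<Longrightarrow> alg_hom free_scale free_scale \<phi> \<Longrightarrow> f \<in> V \<Longrightarrow> \<phi> f \<in> V"
  unfolding T_space_def by blast

definition comm_space :: "'k::field free_algebra set" where
  "comm_space = T_space_gen {commutator (var 1) (var 2),
     commutator (var 1) (var 2) * commutator (var 3) (var 4)}"

lemma subspace_comm_space: "free.subspace comm_space"
  unfolding comm_space_def by (intro T_space_subspace T_space_T_space_gen)

lemma commutator_mult_in_comm_space: "commutator a b * commutator c d \<in> comm_space"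
  and commutator_in_comm_space: "commutator a b \<in> comm_space"
proof -
  obtain \<phi> :: "'a free_algebra \<Rightarrow> 'a free_algebra"
    where \<phi>: "alg_hom free_scale free_scale \<phi>" "\<And>i. \<phi> (letter i) = [a, b, c, d] ! i"
    using free_algebra_hom_exists[OF algebra_scale_free] by blast
  have "\<phi> (commutator (var 1) (var 2)) \<in> comm_space"
    "\<phi> (commutator (var 1) (var 2) * commutator (var 3) (var 4)) \<in> comm_space"
    unfolding comm_space_def
    by (rule T_space_hom[OF T_space_T_space_gen \<phi>(1)], rule T_space_gen_base, simp)+
  then show "commutator a b \<in> comm_space" "commutator a b * commutator c d \<in> comm_space"
    by (simp_all add: alg_homD[OF \<phi>(1)] var_letter \<phi>(2))
qed

text \<open>Polynomials without constant term do not form a T-space, since a letter may be sent to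
  1; the T-space \<open>?Z\<close> therefore imposes the condition on all images. The lemma makes
  the quotient ring below nonzero and removes the constants in characteristic 0.\<close>

lemma augmentation_comm_space:
  assumes "f \<in> comm_space"
  shows "Poly_Mapping.lookup f 0 = 0"
proof -
  let ?Z = "{f :: 'a free_algebra. \<forall>\<phi>. alg_hom free_scale free_scale \<phi> \<longrightarrow>
    Poly_Mapping.lookup (\<phi> f) 0 = 0}"
  have "T_space ?Z"
    unfolding T_space_def
  proof (intro conjI allI impI)
    show "free.subspace ?Z"
      unfolding free.subspace_def by (auto simp: alg_homD lookup_add lookup_free_scale)
    show "\<psi> ` ?Z \<subseteq> ?Z" if "alg_hom free_scale free_scale \<psi>" for \<psi>
      using alg_hom_compose[OF that] by (fastforce simp: o_def)
  qed
  moreover have "Poly_Mapping.lookup (commutator a b) 0 = 0" for a b :: "'a free_algebra"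
    by (simp add: commutator_def lookup_minus augmentation_mult)
  ultimately have "comm_space \<subseteq> ?Z"
    unfolding comm_space_def
    by (intro T_space_gen_subset) (auto simp: alg_homD augmentation_mult)
  moreover have "alg_hom free_scale free_scale (\<lambda>f :: 'a free_algebra. f)"
    using vector_space_free_scale by (simp add: alg_hom_def Vector_Spaces.linear_iff)
  ultimately show ?thesis
    using assms by auto
qed

text \<open>The largest two-sided ideal inside the T-space. It contains all triple commutators, because
  \<open>[[a, b], c] z = [[a, b] z, c] - [a, b] [z, c]\<close>.\<close>

definition comm_ideal :: "'k::field free_algebra set" where
  "comm_ideal = {f. \<forall>a b. a * f * b \<in> comm_space}"

lemma comm_ideal_subset: "f \<in> comm_ideal \<Longrightarrow> f \<in> comm_space"
  unfolding comm_ideal_def by (metis (mono_tags) mem_Collect_eq mult.left_neutral mult.right_neutral)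

lemma comm_ideal_mult_left: "f \<in> comm_ideal \<Longrightarrow> a * f \<in> comm_ideal"
  and comm_ideal_mult_right: "f \<in> comm_ideal \<Longrightarrow> f * a \<in> comm_ideal"
  unfolding comm_ideal_def by (simp_all add: mult.assoc) (simp flip: mult.assoc)

lemma subspace_comm_ideal: "free.subspace comm_ideal"
proof -
  have "a * free_scale c f * b = free_scale c (a * f * b)" for a b f :: "'a free_algebra" and c
    using algebra_scale_free unfolding algebra_scale_def by metis
  then show ?thesis
    using subspace_comm_space
    by (auto simp: comm_ideal_def free.subspace_def distrib_left distrib_right)
qed

lemma triple_commutator_in_comm_ideal: "commutator (commutator a b) c \<in> comm_ideal"
  unfolding comm_ideal_def
proof (clarify)
  fix x y :: "'a free_algebra"
  let ?u = "commutator a b"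
  \<comment> \<open>The first commutator carries the left factor \<open>x\<close> around to the
    right, which leaves a right multiple by z = y x.\<close>
  have "x * commutator ?u c * y = commutator x (commutator ?u c * y) +
      (commutator (?u * (y * x)) c - commutator a b * commutator (y * x) c)"
    by (simp add: commutator_def algebra_simps)
  also have "\<dots> \<in> comm_space"
    by (intro free.subspace_add free.subspace_diff subspace_comm_space commutator_in_comm_space
        commutator_mult_in_comm_space)
  finally show "x * commutator ?u c * y \<in> comm_space" .
qed

\<comment> \<open>A type of its own, so that the rules of \<open>lie_nilpotent\<close> apply to
  congruences modulo \<open>comm_ideal\<close>.\<close>
quotient_type (overloaded) 'k comm_quot =
  "'k::field free_algebra" / "\<lambda>f g. f - g \<in> comm_ideal"
proof (rule equivpI)
  note add = free.subspace_add[OF subspace_comm_ideal] and neg = free.subspace_neg[OF subspace_comm_ideal]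
  show "reflp (\<lambda>f g. f - g \<in> (comm_ideal :: 'k free_algebra set))"
    by (rule reflpI) (simp add: free.subspace_0[OF subspace_comm_ideal])
  show "symp (\<lambda>f g. f - g \<in> (comm_ideal :: 'k free_algebra set))"
  proof (rule sympI)
    show "g - f \<in> comm_ideal" if "f - g \<in> comm_ideal" for f g :: "'k free_algebra"
      using neg[OF that] by simp
  qed
  show "transp (\<lambda>f g. f - g \<in> (comm_ideal :: 'k free_algebra set))"
  proof (rule transpI)
    show "f - h \<in> comm_ideal" if "f - g \<in> comm_ideal" "g - h \<in> comm_ideal"
      for f g h :: "'k free_algebra"
      using add[OF that] by simp
  qed
qed

instantiation comm_quot :: (field) ring_1
begin

lift_definition zero_comm_quot :: "'a comm_quot" is 0 .

lift_definition one_comm_quot :: "'a comm_quot" is 1 .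

lift_definition plus_comm_quot :: "'a comm_quot \<Rightarrow> 'a comm_quot \<Rightarrow> 'a comm_quot" is "(+)"
proof -
  fix f f' g g' :: "'a free_algebra"
  assume "f - f' \<in> comm_ideal" "g - g' \<in> comm_ideal"
  then have "(f - f') + (g - g') \<in> comm_ideal"
    by (intro free.subspace_add subspace_comm_ideal)
  then show "f + g - (f' + g') \<in> comm_ideal"
    by (simp add: algebra_simps)
qed

lift_definition uminus_comm_quot :: "'a comm_quot \<Rightarrow> 'a comm_quot" is uminus
proof -
  fix f f' :: "'a free_algebra"
  assume "f - f' \<in> comm_ideal"
  then have "- (f - f') \<in> comm_ideal"
    by (intro free.subspace_neg subspace_comm_ideal)
  then show "- f - - f' \<in> comm_ideal"
    by simp
qed

lift_definition minus_comm_quot :: "'a comm_quot \<Rightarrow> 'a comm_quot \<Rightarrow> 'a comm_quot" is "(-)"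
proof -
  fix f f' g g' :: "'a free_algebra"
  assume "f - f' \<in> comm_ideal" "g - g' \<in> comm_ideal"
  then have "(f - f') - (g - g') \<in> comm_ideal"
    by (rule free.subspace_diff[OF subspace_comm_ideal])
  then show "f - g - (f' - g') \<in> comm_ideal"
    by (simp add: algebra_simps)
qed

lift_definition times_comm_quot :: "'a comm_quot \<Rightarrow> 'a comm_quot \<Rightarrow> 'a comm_quot" is "(*)"
proof -
  fix f f' g g' :: "'a free_algebra"
  assume "f - f' \<in> comm_ideal" "g - g' \<in> comm_ideal"
  then have "(f - f') * g + f' * (g - g') \<in> comm_ideal"
    by (rule free.subspace_add[OF subspace_comm_ideal comm_ideal_mult_right comm_ideal_mult_left])
  then show "f * g - f' * g' \<in> comm_ideal"
    by (simp add: algebra_simps)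
qed

instance
proof
  have "(1 :: 'a free_algebra) \<notin> comm_space"
    using augmentation_comm_space[of "1 :: 'a free_algebra"] by auto
  then have "(1 :: 'a free_algebra) \<notin> comm_ideal"
    using comm_ideal_subset by blast
  then have "0 - (1 :: 'a free_algebra) \<notin> comm_ideal"
    using free.subspace_neg[OF subspace_comm_ideal, of "- 1 :: 'a free_algebra"] by auto
  then show "(0 :: 'a comm_quot) \<noteq> 1"
    by transfer
  fix a b c :: "'a comm_quot"
  note [simp] = free.subspace_0[OF subspace_comm_ideal]
  show "a + b + c = a + (b + c)"
    by transfer (simp add: algebra_simps)
  show "a + b = b + a"
    by transfer (simp add: algebra_simps)
  show "0 + a = a"
    by transfer simp
  show "- a + a = 0"
    by transfer simp
  show "a - b = a + - b"
    by transfer simp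
  show "a * b * c = a * (b * c)"
    by transfer (simp add: algebra_simps)
  show "1 * a = a"
    by transfer simp
  show "a * 1 = a"
    by transfer simp
  show "(a + b) * c = a * c + b * c"
    by transfer (simp add: algebra_simps)
  show "a * (b + c) = a * b + a * c"
    by transfer (simp add: algebra_simps)
qed

end

lift_definition comm_quot_scale :: "'k::field \<Rightarrow> 'k comm_quot \<Rightarrow> 'k comm_quot" is free_scale
proof -
  fix c :: 'k and f g :: "'k free_algebra"
  assume "f - g \<in> comm_ideal"
  then have "free_scale c (f - g) \<in> comm_ideal"
    by (intro free.subspace_scale subspace_comm_ideal)
  then show "free_scale c f - free_scale c g \<in> comm_ideal"
    by (simp add: free.scale_right_diff_distrib)
qed

lemma vector_space_comm_quot_scale: "vector_space comm_quot_scale"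
  by standard
    (transfer; simp add: free.scale_right_distrib free.scale_left_distrib
      free.subspace_0[OF subspace_comm_ideal])+

lemma alg_hom_comm_quot: "alg_hom free_scale comm_quot_scale abs_comm_quot"
  unfolding alg_hom_def Vector_Spaces.linear_iff
  by (simp add: vector_space_free_scale vector_space_comm_quot_scale plus_comm_quot.abs_eq
      comm_quot_scale.abs_eq one_comm_quot.abs_eq times_comm_quot.abs_eq)

lemma lie_nilpotent_comm_quot:
  assumes "(2 :: 'k::field) \<noteq> 0"
  shows "lie_nilpotent TYPE('k comm_quot)"
proof
  show "commutator (commutator a b) c = 0" for a b c :: "'k comm_quot"
    unfolding commutator_def
    by transfer (use triple_commutator_in_comm_ideal in \<open>simp add: commutator_def\<close>)
  show "a = 0" if "a + a = 0" for a :: "'k comm_quot"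
    using that
  proof transfer
    fix f :: "'k free_algebra"
    assume "f + f - 0 \<in> comm_ideal"
    moreover have "f + f = free_scale 2 f"
      using free.scale_left_distrib[of 1 1 f] by simp
    ultimately have "free_scale 2 f \<in> comm_ideal"
      by (simp only: diff_zero)
    then have "free_scale (inverse 2) (free_scale 2 f) \<in> comm_ideal"
      by (rule free.subspace_scale[OF subspace_comm_ideal])
    then show "f - 0 \<in> comm_ideal"
      using assms by simp
  qed
qed

section \<open>Reduction to normal forms\<close>

text \<open>This carries computations in the quotient back to the free algebra: for subspaces
  containing \<open>comm_ideal\<close>, membership depends on the class only.\<close>

lemma quot_eq_in_subspace:
  assumes "abs_comm_quot f = abs_comm_quot g" "free.subspace U" "comm_ideal \<subseteq> U" "g \<in> U"
  shows "f \<in> U"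
proof -
  have "f - g \<in> U"
    using assms(1,3) by (auto simp: comm_quot.abs_eq_iff)
  then have "f - g + g \<in> U"
    using assms(2,4) by (intro free.subspace_add)
  then show ?thesis
    by simp
qed

text \<open>The index \<open>m\<close> is the multidegree and not the exponent vector: a letter in
  \<open>I\<close> occurs once in the commutators, and its exponent is lowered by one. The
  subtraction is exact if \<open>I\<close> lies in the support of \<open>m\<close>.\<close>

definition norm_form :: "nat \<Rightarrow> (nat \<Rightarrow> nat) \<Rightarrow> nat set \<Rightarrow> 'k::field free_algebra" where
  "norm_form n m I = monom_prod letter (\<lambda>i. m i - (if i \<in> I then 1 else 0)) n *
     comm_prod letter (sorted_list_of_set I)"

text \<open>Words are built by appending letters. The span of the monomials and
  \<open>comm_ideal\<close> is stable under this, because \<open>monom_prod_mult_var\<close> sorts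
  the new letter in and the resulting commutators join the list \<open>L\<close>.\<close>

lemma free_algebra_spanned_by_monomials:
  fixes f :: "'k::field free_algebra" and U :: "'k free_algebra set"
  assumes "(2 :: 'k) \<noteq> 0" and U: "free.subspace U" "comm_ideal \<subseteq> U"
    and mon: "\<And>\<alpha> L. set L \<subseteq> {..<n} \<Longrightarrow> monom_prod letter \<alpha> n * comm_prod letter L \<in> U"
    and f: "\<forall>w\<in>Poly_Mapping.keys f. set (letters w) \<subseteq> {..<n}"
  shows "f \<in> U"
proof -
  interpret lie_nilpotent "TYPE('k comm_quot)"
    by (rule lie_nilpotent_comm_quot) fact
  note hom = alg_hom_comm_quot
  define S :: "'k free_algebra set"
    where "S = comm_ideal \<union> {monom_prod letter \<alpha> n * comm_prod letter L |\<alpha> L. set L \<subseteq> {..<n}}"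
  have S_U: "free.span S \<subseteq> U"
    by (rule free.span_minimal) (use U mon in \<open>auto simp: S_def\<close>)
  have comm_S: "comm_ideal \<subseteq> free.span S"
    unfolding S_def using free.span_superset by blast
  have step: "g * letter i \<in> free.span S" if "g \<in> free.span S" and i: "i < n" for g i
    using that(1)
  proof (rule free.span_induct)
    show "free.subspace {g. g * letter i \<in> free.span S}"
    proof -
      have "free_scale c g * letter i = free_scale c (g * letter i)" for c and g :: "'k free_algebra"
        by (simp add: free_scale_conv_mult mult.assoc)
      then show ?thesis
        unfolding free.subspace_def
        by (auto simp: distrib_right free.span_zero free.span_add free.span_scale)
    qed
    fix g assume "g \<in> S"
    then consider "g \<in> comm_ideal" |
      \<alpha> L where "set L \<subseteq> {..<n}" "g = monom_prod letter \<alpha> n * comm_prod letter L"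
      by (auto simp: S_def)
    then show "g * letter i \<in> free.span S"
    proof cases
      case 1
      then show ?thesis
        using comm_S comm_ideal_mult_right by blast
    next
      case 2
      let ?x = "abs_comm_quot \<circ> letter :: nat \<Rightarrow> 'k comm_quot"
      define h :: "'k free_algebra" where "h = monom_prod letter (\<alpha>(i := Suc (\<alpha> i))) n * comm_prod letter L +
        (\<Sum>l\<in>{i<..<n}. of_nat (\<alpha> l) *
          (monom_prod letter (\<alpha>(l := \<alpha> l - 1)) n * comm_prod letter (l # i # L)))"
      have "monom_prod letter \<beta> n * comm_prod letter L' \<in> S" if "set L' \<subseteq> {..<n}" for \<beta> L'
        using that by (auto simp: S_def)
      then have "h \<in> free.span S"
        unfolding h_def of_nat_mult_free
        by (intro free.span_add free.span_sum free.span_scale free.span_base)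
          (use 2 i in \<open>auto simp del: comm_prod.simps\<close>)
      moreover have "abs_comm_quot (g * letter i) = abs_comm_quot h"
      proof -
        have "abs_comm_quot (g * letter i) = monom_prod ?x \<alpha> n * ?x i * comm_prod ?x L"
          unfolding 2 alg_homD[OF hom] alg_hom_monom_prod[OF hom] alg_hom_comm_prod[OF hom] mult.assoc
          using comm_prod_commute[of ?x L "?x i"] by simp
        also have "\<dots> = abs_comm_quot h"
          unfolding monom_prod_mult_var[OF i]
          by (simp add: h_def alg_homD[OF hom] alg_hom_monom_prod[OF hom]
              alg_hom_comm_prod[OF hom] alg_hom_sum[OF hom] alg_hom_of_nat[OF hom]
              distrib_right sum_distrib_right mult.assoc)
        finally show ?thesis .
      qed
      ultimately show ?thesis
        using quot_eq_in_subspace[OF _ free.subspace_span comm_S, of "g * letter i" h] by blast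
    qed
  qed
  have word: "set ws \<subseteq> {..<n} \<Longrightarrow> Poly_Mapping.single (Word ws) 1 \<in> free.span S" for ws
  proof (induction ws rule: rev_induct)
    case Nil
    have "set [] \<subseteq> {..<n}"
      by simp
    then have "monom_prod letter (\<lambda>_. 0) n * comm_prod letter [] \<in> S"
      unfolding S_def by blast
    then have "monom_prod letter (\<lambda>_. 0) n * comm_prod letter [] \<in> free.span S"
      by (rule free.span_base)
    then show ?case
      unfolding zero_word_def[symmetric] single_one by (simp add: monom_prod_zero)
  next
    case (snoc i ws)
    have "Poly_Mapping.single (Word ws) 1 * letter i = Poly_Mapping.single (Word (ws @ [i])) (1 :: 'k)"
      by (simp add: letter_def mult_single plus_word_def)
    then show ?case
      using step[of "Poly_Mapping.single (Word ws) 1" i] snoc by simp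
  qed
  have "f = (\<Sum>w\<in>Poly_Mapping.keys f. free_scale (Poly_Mapping.lookup f w) (Poly_Mapping.single w 1))"
    by (rule trans[OF poly_mapping_sum_single]) (simp add: free_scale_conv_mult mult_single)
  also have "\<dots> \<in> free.span S"
  proof (intro free.span_sum free.span_scale)
    fix w assume "w \<in> Poly_Mapping.keys f"
    then show "Poly_Mapping.single w 1 \<in> free.span S"
      using f word[of "letters w"] by simp
  qed
  finally show ?thesis
    using S_U by blast
qed

lemma norm_form_quot:
  assumes "(2 :: 'k::field) \<noteq> 0" and L: "distinct L" "set L \<subseteq> {..<n}"
    and m: "\<And>i. i < n \<Longrightarrow> m i = \<alpha> i + (if i \<in> set L then 1 else 0)"
  shows "abs_comm_quot (monom_prod letter \<alpha> n * comm_prod letter L :: 'k free_algebra) =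
      abs_comm_quot (norm_form n m (set L)) \<or>
    abs_comm_quot (monom_prod letter \<alpha> n * comm_prod letter L :: 'k free_algebra) =
      abs_comm_quot (- norm_form n m (set L))"
proof -
  interpret lie_nilpotent "TYPE('k comm_quot)"
    by (rule lie_nilpotent_comm_quot) fact
  note hom = alg_hom_comm_quot
  have "mset L = mset (sorted_list_of_set (set L))"
    using L(1) by (simp add: sorted_list_of_set_sort_remdups distinct_remdups_id)
  moreover have "monom_prod letter (\<lambda>i. m i - (if i \<in> set L then 1 else 0)) n =
      (monom_prod letter \<alpha> n :: 'k free_algebra)"
    by (rule monom_prod_cong) (simp add: m)
  ultimately show ?thesis
    using comm_prod_perm[of L "sorted_list_of_set (set L)" "abs_comm_quot \<circ> letter"]
    unfolding norm_form_def
    by (auto simp: alg_homD[OF hom] alg_hom_comm_prod[OF hom])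
qed

text \<open>Modulo \<open>comm_ideal\<close> sorting the list costs at most a sign, which a subspace
  does not see.\<close>

lemma norm_form_in_subspace:
  fixes U :: "'k::field free_algebra set"
  assumes "(2 :: 'k) \<noteq> 0" and U: "free.subspace U" "comm_ideal \<subseteq> U"
    and L: "distinct L" "set L \<subseteq> {..<n}"
    and m: "\<And>i. i < n \<Longrightarrow> m i = \<alpha> i + (if i \<in> set L then 1 else 0)"
  shows "monom_prod letter \<alpha> n * comm_prod letter L \<in> U \<longleftrightarrow> norm_form n m (set L) \<in> U"
proof -
  let ?f = "monom_prod letter \<alpha> n * comm_prod letter L :: 'k free_algebra"
  let ?g = "norm_form n m (set L) :: 'k free_algebra"
  have neg: "- g \<in> U \<longleftrightarrow> g \<in> U" for g
    using free.subspace_neg[OF U(1), of g] free.subspace_neg[OF U(1), of "- g"] by auto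
  have "abs_comm_quot ?f = abs_comm_quot ?g \<or> abs_comm_quot ?f = abs_comm_quot (- ?g)"
    by (rule norm_form_quot) (use assms in auto)
  then show ?thesis
  proof
    assume "abs_comm_quot ?f = abs_comm_quot ?g"
    then show ?thesis
      using quot_eq_in_subspace[OF _ U, of ?f ?g] quot_eq_in_subspace[OF _ U, of ?g ?f] by auto
  next
    assume "abs_comm_quot ?f = abs_comm_quot (- ?g)"
    then have "?f \<in> U \<longleftrightarrow> - ?g \<in> U"
      using quot_eq_in_subspace[OF _ U, of ?f "- ?g"] quot_eq_in_subspace[OF _ U, of "- ?g" ?f] by auto
    then show ?thesis
      by (simp only: neg)
  qed
qed

text \<open>The part of least degree of \<open>norm_form n m I\<close>, as a differential form, is \<open>x^m dlog x_I\<close> up to a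
  scalar. The forms with pivot outside of \<open>I\<close> span a complement of the exact ones.\<close>

definition pivot :: "'k::field itself \<Rightarrow> (nat \<Rightarrow> nat) \<Rightarrow> nat" where
  "pivot _ m = (LEAST j. of_nat (m j) \<noteq> (0 :: 'k))"

definition complement_index :: "'k::field itself \<Rightarrow> nat \<Rightarrow> ((nat \<Rightarrow> nat) \<times> nat set) set" where
  "complement_index k n = {(m, I). (\<forall>i. m i \<noteq> 0 \<longrightarrow> i < n) \<and> I \<subseteq> {i. m i \<noteq> 0} \<and> even (card I) \<and>
     (\<exists>j. of_nat (m j) \<noteq> (0 :: 'k)) \<and> pivot k m \<notin> I}"

text \<open>If the pivot j lies in \<open>I\<close>, an exact element is expanded whose coefficient
  at the normal form of \<open>I\<close> is m_j up to sign. In its other terms j is replaced by some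
  l: either l is repeated and the term vanishes, or the new index set avoids the pivot.\<close>

lemma norm_form_reduction:
  fixes U :: "'k::field free_algebra set"
  assumes two: "(2 :: 'k) \<noteq> 0" and U: "free.subspace U" "comm_space \<subseteq> U"
    and compl: "\<And>m I. (m, I) \<in> complement_index TYPE('k) n \<Longrightarrow> norm_form n m I \<in> U"
    and m: "\<forall>i. m i \<noteq> 0 \<longrightarrow> i < n" "I \<subseteq> {i. m i \<noteq> 0}" "even (card I)" "of_nat (m j') \<noteq> (0 :: 'k)"
  shows "norm_form n m I \<in> U"
proof (cases "pivot TYPE('k) m \<in> I")
  case False
  with m show ?thesis
    by (intro compl) (auto simp: complement_index_def)
next
  case True
  interpret lie_nilpotent "TYPE('k comm_quot)"
    by (rule lie_nilpotent_comm_quot) fact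
  note hom = alg_hom_comm_quot
  define j where "j = pivot TYPE('k) m"
  have mj: "of_nat (m j) \<noteq> (0 :: 'k)"
    unfolding j_def pivot_def by (rule LeastI) (rule m(4))
  have U': "comm_ideal \<subseteq> U"
    using U(2) comm_ideal_subset by blast
  have "{i. m i \<noteq> 0} \<subseteq> {..<n}"
    using m(1) by auto
  then have I: "finite I" "I \<subseteq> {..<n}" "j \<in> I"
    using m(2) True finite_subset[of I "{..<n}"] by (auto simp: j_def)
  \<comment> \<open>Since \<open>I\<close> has even size it contains a second element
    \<open>b\<close>, to be paired with j in a commutator.\<close>
  have "I - {j} \<noteq> {}"
  proof
    assume "I - {j} = {}"
    with I(3) have "I = {j}"
      by blast
    with m(3) show False
      by simp
  qed
  then obtain b where b: "b \<in> I" "b \<noteq> j"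
    by blast
  define J where "J = sorted_list_of_set (I - {j, b})"
  have J: "distinct J" "set J = I - {j, b}"
    using I by (auto simp: J_def)
  have IJ: "set (j # b # J) = I" "distinct (j # b # J)"
    using J I b by auto
  \<comment> \<open>What remains of the multidegree after one occurrence of each letter in
    \<open>b # J\<close> is set aside. The exponent of j is still m_j, hence invertible in
    k.\<close>
  define \<gamma> where "\<gamma> i = m i - (if i \<in> set (b # J) then 1 else 0)" for i
  define T :: "nat \<Rightarrow> 'k free_algebra"
    where "T l = monom_prod letter (\<gamma>(l := \<gamma> l - 1)) n * comm_prod letter (l # b # J)" for l
  \<comment> \<open>For \<open>\<gamma> l = 0\<close> the truncated exponent would give
    \<open>T l\<close> the wrong multidegree, but then its coefficient is 0.\<close>
  have T_U: "free_scale (of_nat (\<gamma> l)) (T l) \<in> U" if l: "l < n" "l \<noteq> j" for l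
  proof (cases "\<gamma> l = 0")
    case True
    then show ?thesis
      using free.subspace_0[OF U(1)] by simp
  next
    case \<gamma>l: False
    have "T l \<in> U"
    proof (cases "l \<in> set (b # J)")
      case True
      then have "comm_prod (abs_comm_quot \<circ> letter) (l # b # J) = (0 :: 'k comm_quot)"
        by (intro comm_prod_not_distinct) auto
      then have "abs_comm_quot (T l) = abs_comm_quot 0"
        unfolding T_def alg_homD[OF hom] alg_hom_comm_prod[OF hom] by simp
      then show ?thesis
        by (rule quot_eq_in_subspace[OF _ U(1) U']) (rule free.subspace_0[OF U(1)])
    next
      case False
      have "norm_form n m (set (l # b # J)) \<in> U"
      proof (rule compl)
        have "card (set (l # b # J)) = card I"
          using False IJ distinct_card[of "l # b # J"] distinct_card[of "j # b # J"] by simp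
        then show "(m, set (l # b # J)) \<in> complement_index TYPE('k) n"
          using m \<gamma>l False l IJ b I by (auto simp: complement_index_def \<gamma>_def j_def[symmetric])
      qed
      then show ?thesis
        unfolding T_def
        by (subst norm_form_in_subspace[where m = m, OF two U(1) U'])
          (use False \<gamma>l IJ I l m(2) b in \<open>auto simp: \<gamma>_def\<close>)
    qed
    then show ?thesis
      by (rule free.subspace_scale[OF U(1)])
  qed
  \<comment> \<open>Up to a scalar, the leading form of \<open>c\<close> is the differential of
    x^\<gamma> dx_J times dx_b.\<close>
  define c where "c = commutator (monom_prod letter \<gamma> n * comm_prod letter J) (letter b :: 'k free_algebra)"
  have "c \<in> U"
    unfolding c_def using commutator_in_comm_space U(2) by blast
  have "abs_comm_quot c = abs_comm_quot (\<Sum>l<n. free_scale (of_nat (\<gamma> l)) (T l))"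
  proof -
    let ?x = "abs_comm_quot \<circ> letter :: nat \<Rightarrow> 'k comm_quot"
    have "abs_comm_quot c = commutator (monom_prod ?x \<gamma> n * comm_prod ?x J) (?x b)"
      by (simp add: c_def alg_homD[OF hom] alg_hom_monom_prod[OF hom] alg_hom_comm_prod[OF hom])
    also have "\<dots> = commutator (monom_prod ?x \<gamma> n) (?x b) * comm_prod ?x J"
      using comm_prod_commute[of ?x J "?x b"] unfolding commutator_mult_left by (simp add: commutator_def)
    also have "\<dots> = abs_comm_quot (\<Sum>l<n. of_nat (\<gamma> l) * T l)"
      unfolding commutator_monom_prod
      by (simp add: T_def alg_homD[OF hom] alg_hom_monom_prod[OF hom] alg_hom_comm_prod[OF hom]
          alg_hom_sum[OF hom] alg_hom_of_nat[OF hom] sum_distrib_right mult.assoc)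
    finally show ?thesis
      by (simp add: of_nat_mult_free)
  qed
  then have "(\<Sum>l<n. free_scale (of_nat (\<gamma> l)) (T l)) \<in> U"
    by (rule quot_eq_in_subspace[OF sym U(1) U' \<open>c \<in> U\<close>])
  moreover have "(\<Sum>l\<in>{..<n} - {j}. free_scale (of_nat (\<gamma> l)) (T l)) \<in> U"
    by (rule free.subspace_sum[OF U(1)]) (use T_U in auto)
  moreover have "(\<Sum>l<n. free_scale (of_nat (\<gamma> l)) (T l)) =
      free_scale (of_nat (\<gamma> j)) (T j) + (\<Sum>l\<in>{..<n} - {j}. free_scale (of_nat (\<gamma> l)) (T l))"
    by (rule sum.remove) (use I in auto)
  ultimately have "free_scale (of_nat (\<gamma> j)) (T j) +
      (\<Sum>l\<in>{..<n} - {j}. free_scale (of_nat (\<gamma> l)) (T l)) -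
      (\<Sum>l\<in>{..<n} - {j}. free_scale (of_nat (\<gamma> l)) (T l)) \<in> U"
    by (intro free.subspace_diff[OF U(1)]) (simp only:)
  moreover have "\<gamma> j = m j"
    using IJ(2) by (simp add: \<gamma>_def)
  ultimately have "free_scale (of_nat (m j)) (T j) \<in> U"
    by (simp only: add_diff_cancel_right')
  then have "free_scale (inverse (of_nat (m j))) (free_scale (of_nat (m j)) (T j)) \<in> U"
    by (rule free.subspace_scale[OF U(1)])
  then have "T j \<in> U"
    using mj by simp
  moreover have "T j \<in> U \<longleftrightarrow> norm_form n m (set (j # b # J)) \<in> U"
    unfolding T_def
    by (rule norm_form_in_subspace[OF two U(1) U'])
      (use IJ I m(2) b J in \<open>auto simp: \<gamma>_def\<close>)
  ultimately show ?thesis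
    unfolding IJ(1) by blast
qed

text \<open>Multidegrees that are nonzero in k are handled by \<open>norm_form_reduction\<close>.
  For the others the differential vanishes and nothing can be exchanged; their normal forms have to
  lie in V, which is the assumption \<open>closed\<close>.\<close>

lemma spanned_by_complement:
  fixes V :: "'k::field free_algebra set"
  assumes two: "(2 :: 'k) \<noteq> 0" and V: "free.subspace V" "comm_space \<subseteq> V"
    and closed: "\<And>n m I. \<forall>i. of_nat (m i) = (0 :: 'k) \<Longrightarrow> \<forall>i. m i \<noteq> 0 \<longrightarrow> i < n \<Longrightarrow>
      I \<subseteq> {i. m i \<noteq> 0} \<Longrightarrow> even (card I) \<Longrightarrow> norm_form n m I \<in> V"
  obtains n where "f \<in> free.span (V \<union> (\<lambda>(m, I). norm_form n m I) ` complement_index TYPE('k) n)"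
proof -
  have "finite (\<Union>w\<in>Poly_Mapping.keys f. set (letters w))"
    by simp
  then obtain n where n: "\<forall>w\<in>Poly_Mapping.keys f. set (letters w) \<subseteq> {..<n}"
    unfolding finite_nat_set_iff_bounded by fastforce
  define U where "U = free.span (V \<union> (\<lambda>(m, I). norm_form n m I) ` complement_index TYPE('k) n)"
  have V_U: "V \<subseteq> U"
    unfolding U_def using free.span_superset by blast
  have U: "free.subspace U" "comm_space \<subseteq> U"
    using V(2) V_U by (auto simp: U_def)
  have U': "comm_ideal \<subseteq> U"
    using U(2) comm_ideal_subset by blast
  have compl: "norm_form n m I \<in> U" if "(m, I) \<in> complement_index TYPE('k) n" for m I
    unfolding U_def using that by (intro free.span_base) auto
  have "monom_prod letter \<alpha> n * comm_prod letter L \<in> U" if L: "set L \<subseteq> {..<n}" for \<alpha> L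
  proof (cases "distinct L \<and> even (length L)")
    case False
    interpret lie_nilpotent "TYPE('k comm_quot)"
      by (rule lie_nilpotent_comm_quot) fact
    have "comm_prod (abs_comm_quot \<circ> letter) L = (0 :: 'k comm_quot)"
      using False comm_prod_not_distinct comm_prod_odd by blast
    then have "abs_comm_quot (monom_prod letter \<alpha> n * comm_prod letter L) = abs_comm_quot (0 :: 'k free_algebra)"
      unfolding alg_homD[OF alg_hom_comm_quot] alg_hom_comm_prod[OF alg_hom_comm_quot] by simp
    then show ?thesis
      by (rule quot_eq_in_subspace[OF _ U(1) U']) (rule free.subspace_0[OF U(1)])
  next
    case True
    define m where "m i = (if i < n then \<alpha> i + (if i \<in> set L then 1 else 0) else 0)" for i
    have m: "\<forall>i. m i \<noteq> 0 \<longrightarrow> i < n" "set L \<subseteq> {i. m i \<noteq> 0}" "even (card (set L))"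
      using L True by (auto simp: m_def distinct_card)
    have "norm_form n m (set L) \<in> U"
    proof (cases "\<forall>i. of_nat (m i) = (0 :: 'k)")
      case True
      then show ?thesis
        using closed[OF _ m] V_U by blast
    next
      case False
      then obtain j where j: "of_nat (m j) \<noteq> (0 :: 'k)"
        by blast
      show ?thesis
        by (rule norm_form_reduction[OF two U _ m j]) (rule compl)
    qed
    then show ?thesis
      by (subst norm_form_in_subspace[where m = m, OF two U(1) U']) (use True L in \<open>auto simp: m_def\<close>)
  qed
  then have "f \<in> U"
    by (rule free_algebra_spanned_by_monomials[OF two U(1) U' _ n])
  then show ?thesis
    using that unfolding U_def by blast
qed

section \<open>Independence of the normal forms\<close>

lemma power_separation:
  assumes "infinite (UNIV :: 'k::field set)" "a \<noteq> b"
  obtains r :: "'k::field" where "r ^ a \<noteq> r ^ b"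
proof -
  define q :: "'k poly" where "q = Polynomial.monom 1 a - Polynomial.monom 1 b"
  have "coeff q a = 1"
    using assms(2) by (simp add: q_def)
  then have "q \<noteq> 0"
    by auto
  then have "finite {r. poly q r = 0}"
    by (rule poly_roots_finite)
  then have "{r. poly q r = 0} \<noteq> UNIV"
    using assms(1) by metis
  then obtain r where "poly q r \<noteq> 0"
    by blast
  then show ?thesis
    using that by (simp add: q_def poly_monom)
qed

lemma prod_power_fun_upd:
  fixes s :: "nat \<Rightarrow> 'k::field"
  assumes "j < n"
  shows "(\<Prod>i<n. (s(j := r * s j)) i ^ m i) = r ^ m j * (\<Prod>i<n. s i ^ m i)"
proof -
  have "(\<Prod>i\<in>{..<n} - {j}. (s(j := r * s j)) i ^ m i) = (\<Prod>i\<in>{..<n} - {j}. s i ^ m i)"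
    by (intro prod.cong) auto
  then show ?thesis
    using assms by (simp add: prod.remove[of "{..<n}" j] power_mult_distrib mult.assoc)
qed

text \<open>As for independence of characters: replacing s_j by r s_j and subtracting r^(m0 j) times
  the original relation eliminates \<open>m0\<close>, and r is chosen so that the coefficient of
  \<open>m1\<close> survives. Setting all s_i = 1 then disposes of \<open>m0\<close>.\<close>

lemma monomial_functions_independent:
  fixes c :: "(nat \<Rightarrow> nat) \<Rightarrow> 'k::field"
  assumes "infinite (UNIV :: 'k set)" "finite M" "\<And>m i. m \<in> M \<Longrightarrow> m i \<noteq> 0 \<Longrightarrow> i < n"
    and "\<And>s :: nat \<Rightarrow> 'k. (\<Sum>m\<in>M. c m * (\<Prod>i<n. s i ^ m i)) = 0"
  shows "\<forall>m\<in>M. c m = 0"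
  using assms(2-4)
proof (induction M arbitrary: c rule: finite_induct)
  case (insert m0 M)
  have zero: "c m1 = 0" if m1: "m1 \<in> M" for m1
  proof -
    have "m1 \<noteq> m0"
      using m1 insert.hyps(2) by blast
    then obtain j where j: "m1 j \<noteq> m0 j"
      by fastforce
    then have "m0 j \<noteq> 0 \<or> m1 j \<noteq> 0"
      by auto
    then have "j < n"
      using insert.prems(1) m1 by blast
    obtain r :: 'k where r: "r ^ m1 j \<noteq> r ^ m0 j"
      using power_separation[OF assms(1) j] .
    have "(\<Sum>m\<in>M. (c m * (r ^ m j - r ^ m0 j)) * (\<Prod>i<n. s i ^ m i)) = 0" for s
    proof -
      have "(\<Sum>m\<in>M. (c m * (r ^ m j - r ^ m0 j)) * (\<Prod>i<n. s i ^ m i)) =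
          (\<Sum>m\<in>insert m0 M. (c m * (r ^ m j - r ^ m0 j)) * (\<Prod>i<n. s i ^ m i))"
        using insert.hyps by simp
      also have "\<dots> = (\<Sum>m\<in>insert m0 M. c m * (\<Prod>i<n. (s(j := r * s j)) i ^ m i)) -
          r ^ m0 j * (\<Sum>m\<in>insert m0 M. c m * (\<Prod>i<n. s i ^ m i))"
        unfolding prod_power_fun_upd[OF \<open>j < n\<close>] sum_distrib_left sum_subtractf[symmetric]
        by (intro sum.cong) (simp_all add: algebra_simps)
      also have "\<dots> = 0"
        by (simp only: insert.prems(2)) simp
      finally show ?thesis .
    qed
    then have "\<forall>m\<in>M. c m * (r ^ m j - r ^ m0 j) = 0"
      by (intro insert.IH) (use insert.prems(1) in auto)
    then have "c m1 * (r ^ m1 j - r ^ m0 j) = 0"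
      using m1 by blast
    then show ?thesis
      using r by simp
  qed
  then have "c m0 = 0"
    using insert.prems(2)[of "\<lambda>_. 1"] insert.hyps by simp
  then show ?case
    using zero by simp
qed simp

section \<open>Values of the normal forms at s_i (1 + e_i)\<close>

lemma monom_prod_scale:
  "monom_prod (\<lambda>i. grassmann_scale (s i) (y i)) \<alpha> n =
    grassmann_scale (\<Prod>i<n. s i ^ \<alpha> i) (monom_prod y \<alpha> n)"
proof -
  interpret vector_space "grassmann_scale :: 'a \<Rightarrow> _"
    by (rule vector_space_grassmann_scale)
  have "grassmann_scale c a ^ k = grassmann_scale (c ^ k) (a ^ k)" for c :: 'a and a k
    by (induction k) (simp_all add: grassmann_scale_mult[symmetric] grassmann_scale_one mult.commute)
  then show ?thesis
    by (induction n)
      (simp_all add: monom_prod_Suc grassmann_scale_one grassmann_scale_mult[symmetric] mult.commute)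
qed

lemma comm_prod_scale:
  "comm_prod (\<lambda>i. grassmann_scale (s i) (y i)) L =
    grassmann_scale (prod_list (map s L)) (comm_prod y L)"
proof -
  interpret vector_space "grassmann_scale :: 'a \<Rightarrow> _"
    by (rule vector_space_grassmann_scale)
  have "commutator (grassmann_scale c a) (grassmann_scale d b) = grassmann_scale (c * d) (commutator a b)"
    for c d :: 'a and a b
    by (simp add: commutator_def grassmann_scale_mult[symmetric] scale_right_diff_distrib mult.commute)
  then show ?thesis
    by (induction y L rule: comm_prod.induct)
      (simp_all add: grassmann_scale_one grassmann_scale_mult[symmetric] mult.commute mult.left_commute)
qed

text \<open>The value of \<open>norm_form n m I\<close> at x_i = 1 + e_i, free of the scalars
  s_i.\<close>

definition norm_value :: "nat \<Rightarrow> (nat \<Rightarrow> nat) \<Rightarrow> nat set \<Rightarrow> 'k::field grassmann" where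
  "norm_value n m I = monom_prod (\<lambda>i. 1 + grassmann_gen i) (\<lambda>i. m i - (if i \<in> I then 1 else 0)) n *
     comm_prod (\<lambda>i. 1 + grassmann_gen i) (sorted_list_of_set I)"

text \<open>A letter i < n occurs m_i times in the normal form, counting its occurrence in a
  commutator if i is in \<open>I\<close>; hence the factor s^m.\<close>

lemma norm_form_eval:
  assumes hom: "alg_hom free_scale grassmann_scale \<phi>"
    and \<phi>: "\<And>i. \<phi> (letter i) = grassmann_scale (s i) (1 + grassmann_gen i)"
    and I: "I \<subseteq> {i. m i \<noteq> 0}" "I \<subseteq> {..<n}"
  shows "\<phi> (norm_form n m I) = grassmann_scale (\<Prod>i<n. s i ^ m i) (norm_value n m I)"
proof -
  interpret vector_space "grassmann_scale :: 'a \<Rightarrow> _"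
    by (rule vector_space_grassmann_scale)
  let ?y = "\<lambda>i. 1 + grassmann_gen i :: 'a grassmann"
  have fin: "finite I"
    using I(2) finite_subset by blast
  have "prod_list (map s (sorted_list_of_set I)) = (\<Prod>i\<in>I. s i)"
    using fin prod.distinct_set_conv_list[of "sorted_list_of_set I" s] by simp
  also have "\<dots> = (\<Prod>i<n. if i \<in> I then s i else 1)"
    using I(2) fin by (simp add: prod.If_cases Int_absorb1)
  finally have "(\<Prod>i<n. s i ^ (m i - (if i \<in> I then 1 else 0))) *
      prod_list (map s (sorted_list_of_set I)) =
      (\<Prod>i<n. s i ^ (m i - (if i \<in> I then 1 else 0)) * (if i \<in> I then s i else 1))"
    by (simp only: prod.distrib)
  also have "\<dots> = (\<Prod>i<n. s i ^ m i)"
    using I(1) by (intro prod.cong refl) (auto simp: power_eq_if subset_iff mult.commute)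
  finally have prod: "(\<Prod>i<n. s i ^ (m i - (if i \<in> I then 1 else 0))) *
      prod_list (map s (sorted_list_of_set I)) = (\<Prod>i<n. s i ^ m i)" .
  have "\<phi> \<circ> letter = (\<lambda>i. grassmann_scale (s i) (?y i))"
    using \<phi> by auto
  then have "\<phi> (norm_form n m I) =
      grassmann_scale (\<Prod>i<n. s i ^ (m i - (if i \<in> I then 1 else 0))) (monom_prod ?y (\<lambda>i. m i - (if i \<in> I then 1 else 0)) n) *
      grassmann_scale (prod_list (map s (sorted_list_of_set I))) (comm_prod ?y (sorted_list_of_set I))"
    unfolding norm_form_def alg_homD[OF hom] alg_hom_monom_prod[OF hom] alg_hom_comm_prod[OF hom]
    by (simp only: monom_prod_scale comm_prod_scale)
  also have "\<dots> = grassmann_scale (\<Prod>i<n. s i ^ m i) (norm_value n m I)"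
    unfolding norm_value_def prod[symmetric] grassmann_scale_mult[symmetric] scale_scale
    by (simp only: grassmann_scale_mult(2)[symmetric] scale_scale mult.commute)
  finally show ?thesis .
qed

lemma coord_norm_value:
  fixes m :: "nat \<Rightarrow> nat"
  assumes "finite I" "even (card I)" "finite B"
  shows "coord (norm_value n m I :: 'k::field grassmann) B =
    (if I \<subseteq> B then 2 ^ (card I div 2) * (- 1) ^ inversions (B - I) I *
       coord (monom_prod (\<lambda>i. 1 + grassmann_gen i) (\<lambda>i. m i - (if i \<in> I then 1 else 0)) n) (B - I) else 0)"
proof -
  let ?L = "sorted_list_of_set I"
  have "comm_prod (\<lambda>i. 1 + grassmann_gen i :: 'k grassmann) ?L =
      grassmann_scale (2 ^ (card I div 2)) (grassmann_basis I)"
    using assms by (simp add: comm_prod_one_plus_gen prod_list_grassmann_gen)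
  then show ?thesis
    using assms
    by (simp add: norm_value_def grassmann_scale_mult(2)[symmetric] grassmann_scale.rep_eq coord_mult_basis)
qed

text \<open>Up to a sign and a power of 2 this is the coefficient m_j of dlog x_j dlog x_I in the
  differential of x^m dlog x_I; it is nonzero at the pivot.\<close>

lemma coord_norm_value_insert:
  fixes m :: "nat \<Rightarrow> nat"
  assumes "finite I" "even (card I)" "j \<notin> I" "j < n"
  shows "coord (norm_value n m I :: 'k::field grassmann) (insert j I) =
    2 ^ (card I div 2) * (- 1) ^ inversions {j} I * of_nat (m j)"
proof -
  have "insert j I - I = {j}"
    using assms(3) by blast
  then show ?thesis
    using assms by (auto simp: coord_norm_value coord_monom_prod_one_plus_gen)
qed

text \<open>Unlike the central polynomials, these include identities and constants and so form a
  T-space.\<close>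

definition central_valued :: "'k::field free_algebra set" where
  "central_valued = {f. \<forall>\<phi> :: 'k free_algebra \<Rightarrow> 'k grassmann.
     alg_hom free_scale grassmann_scale \<phi> \<longrightarrow> \<phi> f \<in> center}"

lemma T_space_central_valued: "T_space (central_valued :: 'k::field free_algebra set)"
  unfolding T_space_def
proof (intro conjI allI impI)
  have "grassmann_scale c z \<in> center" if "z \<in> center" for c and z :: "'k grassmann"
    using that unfolding center_def by (simp add: grassmann_scale_mult[symmetric])
  moreover have "y + z \<in> center" if "y \<in> center" "z \<in> center" for y z :: "'k grassmann"
    using that unfolding center_def by (simp add: distrib_left distrib_right)
  moreover have "(0 :: 'k grassmann) \<in> center"
    by (simp add: center_def)
  ultimately show "free.subspace (central_valued :: 'k free_algebra set)"
    by (auto simp: free.subspace_def central_valued_def alg_homD)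
  show "\<psi> ` central_valued \<subseteq> central_valued" if "alg_hom free_scale free_scale \<psi>"
    for \<psi> :: "'k free_algebra \<Rightarrow> 'k free_algebra"
    using alg_hom_compose[OF that] by (fastforce simp: o_def central_valued_def)
qed

text \<open>The odd coordinates of every value vanish. Varying the s_i splits this condition by
  multidegree, and for fixed m the coefficients are shown to vanish by induction on the size of I,
  by looking at the coordinate I \<union> {pivot}.\<close>

lemma central_valued_complement_zero:
  fixes d :: "(nat \<Rightarrow> nat) \<times> nat set \<Rightarrow> 'k::field"
  assumes inf: "infinite (UNIV :: 'k set)" and two: "(2 :: 'k) \<noteq> 0"
    and F: "finite F" "F \<subseteq> complement_index TYPE('k) n"
    and central: "(\<Sum>(m, I)\<in>F. free_scale (d (m, I)) (norm_form n m I)) \<in> central_valued"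
    and x: "x \<in> F"
  shows "d x = 0"
proof -
  have F_D: "finite I" "even (card I)" "I \<subseteq> {i. m i \<noteq> 0}" "I \<subseteq> {..<n}" "pivot TYPE('k) m \<notin> I"
    "of_nat (m (pivot TYPE('k) m)) \<noteq> (0 :: 'k)" "pivot TYPE('k) m < n" "\<And>i. m i \<noteq> 0 \<Longrightarrow> i < n"
    if "(m, I) \<in> F" for m I
  proof -
    have c: "(m, I) \<in> complement_index TYPE('k) n"
      using that F(2) by blast
    then show *: "even (card I)" "I \<subseteq> {i. m i \<noteq> 0}" "I \<subseteq> {..<n}" "pivot TYPE('k) m \<notin> I"
      "\<And>i. m i \<noteq> 0 \<Longrightarrow> i < n"
      by (auto simp: complement_index_def)
    show "finite I"
      using *(3) finite_subset by blast
    obtain j where "of_nat (m j) \<noteq> (0 :: 'k)"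
      using c by (auto simp: complement_index_def)
    then show piv: "of_nat (m (pivot TYPE('k) m)) \<noteq> (0 :: 'k)"
      unfolding pivot_def by (rule LeastI)
    show "pivot TYPE('k) m < n"
      using piv by (intro *(5)) (metis of_nat_0)
  qed
  have coord_zero: "(\<Sum>x\<in>{x \<in> F. fst x = m}. d x * coord (norm_value n m (snd x)) B) = 0"
    if B: "odd (card B)" and m: "m \<in> fst ` F" for B m
  proof -
    have "(\<Sum>m\<in>fst ` F. (\<Sum>x\<in>{x \<in> F. fst x = m}. d x * coord (norm_value n m (snd x)) B) *
        (\<Prod>i<n. s i ^ m i)) = 0" for s :: "nat \<Rightarrow> 'k"
    proof -
      obtain \<phi> :: "'k free_algebra \<Rightarrow> 'k grassmann" where hom: "alg_hom free_scale grassmann_scale \<phi>"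
        and \<phi>: "\<And>i. \<phi> (letter i) = grassmann_scale (s i) (1 + grassmann_gen i)"
        using free_algebra_hom_exists[OF algebra_scale_grassmann,
            of "\<lambda>i. grassmann_scale (s i) (1 + grassmann_gen i)"] by blast
      have "\<phi> (\<Sum>(m, I)\<in>F. free_scale (d (m, I)) (norm_form n m I)) \<in> center"
        using central hom by (auto simp: central_valued_def)
      then have "0 = coord (\<phi> (\<Sum>(m, I)\<in>F. free_scale (d (m, I)) (norm_form n m I))) B"
        using center_coord_odd[OF two _ B] by simp
      also have "\<dots> = (\<Sum>x\<in>F. coord (\<phi> (free_scale (d x) (norm_form n (fst x) (snd x)))) B)"
        by (simp add: alg_hom_sum[OF hom] coord_sum case_prod_beta)
      also have "\<dots> = (\<Sum>x\<in>F. d x * coord (norm_value n (fst x) (snd x)) B * (\<Prod>i<n. s i ^ fst x i))"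
      proof (rule sum.cong)
        fix x assume "x \<in> F"
        then have "(fst x, snd x) \<in> F"
          by simp
        note D = F_D[OF this]
        show "coord (\<phi> (free_scale (d x) (norm_form n (fst x) (snd x)))) B =
            d x * coord (norm_value n (fst x) (snd x)) B * (\<Prod>i<n. s i ^ fst x i)"
          by (simp add: alg_homD(2)[OF hom] norm_form_eval[OF hom \<phi> D(3,4)] grassmann_scale.rep_eq)
      qed simp
      also have "\<dots> = (\<Sum>m\<in>fst ` F. \<Sum>x\<in>{x \<in> F. fst x = m}.
          d x * coord (norm_value n (fst x) (snd x)) B * (\<Prod>i<n. s i ^ fst x i))"
        by (rule sum.image_gen[OF F(1)])
      also have "\<dots> = (\<Sum>m\<in>fst ` F. (\<Sum>x\<in>{x \<in> F. fst x = m}. d x * coord (norm_value n m (snd x)) B) *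
        (\<Prod>i<n. s i ^ m i))"
        unfolding sum_distrib_right by (intro sum.cong) auto
      finally show ?thesis
        by simp
    qed
    moreover have "i < n" if "m \<in> fst ` F" "m i \<noteq> 0" for m i
      using F_D(8) that by (metis imageE prod.collapse)
    moreover have "finite (fst ` F)"
      using F(1) by simp
    ultimately have "\<forall>m\<in>fst ` F. (\<Sum>x\<in>{x \<in> F. fst x = m}. d x * coord (norm_value n m (snd x)) B) = 0"
      using monomial_functions_independent[OF inf, of "fst ` F" n
          "\<lambda>m. \<Sum>x\<in>{x \<in> F. fst x = m}. d x * coord (norm_value n m (snd x)) B"] by blast
    then show ?thesis
      using m by blast
  qed
  show ?thesis
    using x
  proof (induction "card (snd x)" arbitrary: x rule: less_induct)
    case less
    obtain m I where x: "x = (m, I)"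
      by fastforce
    have mI: "(m, I) \<in> F"
      using less.prems x by simp
    note D = F_D[OF mI]
    define j where "j = pivot TYPE('k) m"
    define B where "B = insert j I"
    have "odd (card B)"
      using D by (simp add: B_def j_def)
    moreover have "m \<in> fst ` F"
      using mI by force
    ultimately have "(\<Sum>x\<in>{x \<in> F. fst x = m}. d x * coord (norm_value n m (snd x)) B) = 0"
      by (rule coord_zero)
    moreover have others: "d y * coord (norm_value n m (snd y)) B = 0"
      if y: "y \<in> {x \<in> F. fst x = m} - {(m, I)}" for y
    proof -
      obtain I' where y': "y = (m, I')" "(m, I') \<in> F" "I' \<noteq> I"
        using y by (cases y) auto
      note D' = F_D[OF y'(2)]
      show ?thesis
      proof (cases "card I' < card I")
        case True
        then have "d y = 0"
          using less.hyps[of y] y' x by simp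
        then show ?thesis
          by simp
      next
        case False
        \<comment> \<open>A normal form has coordinates only at supersets of its index set. Since
          \<open>I'\<close> avoids the pivot, lying in \<open>B\<close> would make it a proper
          subset of \<open>I\<close>, a case settled by induction.\<close>
        have "\<not> I' \<subseteq> B"
        proof
          assume "I' \<subseteq> B"
          then have "I' \<subset> I"
            using D'(5) y'(3) by (auto simp: B_def j_def)
          then show False
            using False psubset_card_mono[OF D(1)] by blast
        qed
        then show ?thesis
          using D(1) D'(1,2) y' by (simp add: coord_norm_value B_def)
      qed
    qed
    moreover have "(\<Sum>x\<in>{x \<in> F. fst x = m}. d x * coord (norm_value n m (snd x)) B) =
        d (m, I) * coord (norm_value n m (snd (m, I))) B +
        (\<Sum>x\<in>{x \<in> F. fst x = m} - {(m, I)}. d x * coord (norm_value n m (snd x)) B)"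
      by (rule sum.remove) (use mI F(1) in auto)
    moreover have "(\<Sum>x\<in>{x \<in> F. fst x = m} - {(m, I)}. d x * coord (norm_value n m (snd x)) B) = 0"
      by (rule sum.neutral) (use others in blast)
    ultimately have "d (m, I) * coord (norm_value n m I) B = 0"
      by simp
    moreover have "coord (norm_value n m I :: 'k grassmann) B \<noteq> 0"
      using D two by (simp add: B_def j_def coord_norm_value_insert)
    ultimately show ?case
      by (simp add: x)
  qed
qed

text \<open>Write f = v + y with v in V and y in the span of the complement. Then y = f - v is
  centrally valued, hence 0.\<close>

lemma central_valued_in_T_space:
  fixes V :: "'k::field free_algebra set"
  assumes inf: "infinite (UNIV :: 'k set)" and two: "(2 :: 'k) \<noteq> 0"
    and V: "free.subspace V" "comm_space \<subseteq> V" "V \<subseteq> central_valued"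
    and closed: "\<And>n m I. \<forall>i. of_nat (m i) = (0 :: 'k) \<Longrightarrow> \<forall>i. m i \<noteq> 0 \<longrightarrow> i < n \<Longrightarrow>
      I \<subseteq> {i. m i \<noteq> 0} \<Longrightarrow> even (card I) \<Longrightarrow> norm_form n m I \<in> V"
    and f: "f \<in> central_valued"
  shows "f \<in> V"
proof -
  define N :: "nat \<Rightarrow> (nat \<Rightarrow> nat) \<times> nat set \<Rightarrow> 'k free_algebra" where "N n = (\<lambda>(m, I). norm_form n m I)" for n
  obtain n where "f \<in> free.span (V \<union> N n ` complement_index TYPE('k) n)"
    unfolding N_def by (rule spanned_by_complement[OF two V(1,2)]) (rule closed)
  moreover have "free.span V = V"
    using V(1) by (simp only: free.span_eq_iff)
  ultimately obtain v y where vy: "f = v + y" "v \<in> V" "y \<in> free.span (N n ` complement_index TYPE('k) n)"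
    unfolding free.span_Un by auto
  then obtain t r where "finite t" "t \<subseteq> N n ` complement_index TYPE('k) n"
    and y: "y = (\<Sum>a\<in>t. free_scale (r a) a)"
    by (auto simp: free.span_explicit)
  \<comment> \<open>One index is chosen for each normal form that occurs, so the sum can be taken
    over indices even if different indices gave equal polynomials.\<close>
  then obtain F where F: "F \<subseteq> complement_index TYPE('k) n" "inj_on (N n) F" "t = N n ` F"
    by (auto simp: subset_image_inj)
  then have "finite F"
    using \<open>finite t\<close> finite_imageD by blast
  define d where "d x = r (N n x)" for x
  have y_F: "y = (\<Sum>(m, I)\<in>F. free_scale (d (m, I)) (norm_form n m I))"
    unfolding y F(3) by (subst sum.reindex[OF F(2)]) (simp add: d_def N_def case_prod_beta)
  have "f - v \<in> central_valued"
    using free.subspace_diff[OF T_space_subspace[OF T_space_central_valued] f] vy(2) V(3) by blast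
  then have "y \<in> central_valued"
    by (simp add: vy(1))
  then have "d x = 0" if "x \<in> F" for x
    using central_valued_complement_zero[OF inf two \<open>finite F\<close> F(1) _ that] y_F by simp
  then have "y = 0"
    unfolding y_F by (intro sum.neutral) auto
  then show ?thesis
    using vy by simp
qed

section \<open>Central polynomials of the Grassmann algebra\<close>

lemma commutator_central_valued:
  assumes "(2 :: 'k::field) \<noteq> 0"
  shows "commutator a b \<in> (central_valued :: 'k free_algebra set)"
    "commutator a b * commutator c d \<in> (central_valued :: 'k free_algebra set)"
proof -
  interpret lie_nilpotent "TYPE('k grassmann)"
    by (rule lie_nilpotent_grassmann) fact
  show "commutator a b \<in> (central_valued :: 'k free_algebra set)"
    "commutator a b * commutator c d \<in> (central_valued :: 'k free_algebra set)"
    by (auto simp: central_valued_def alg_homD intro!: commutator_central mult_center)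
qed

lemma comm_space_central_valued:
  assumes "(2 :: 'k::field) \<noteq> 0"
  shows "comm_space \<subseteq> (central_valued :: 'k free_algebra set)"
  unfolding comm_space_def
  by (rule T_space_gen_subset) (auto intro: commutator_central_valued[OF assms] T_space_central_valued)

lemma commutator_not_identity:
  assumes "(2 :: 'k::field) \<noteq> 0"
  shows "commutator (var 1) (var 2) \<notin> identities (grassmann_scale :: 'k \<Rightarrow> _)"
proof -
  let ?y = "\<lambda>i. 1 + grassmann_gen i :: 'k grassmann"
  obtain \<phi> :: "'k free_algebra \<Rightarrow> 'k grassmann" where hom: "alg_hom free_scale grassmann_scale \<phi>"
    and \<phi>: "\<And>i. \<phi> (letter i) = ?y i"
    using free_algebra_hom_exists[OF algebra_scale_grassmann, of ?y] by blast
  have "\<phi> (commutator (var 1) (var 2)) = comm_prod ?y [0, 1]"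
    by (simp add: alg_homD[OF hom] var_letter \<phi>)
  also have "\<dots> = grassmann_scale 2 (grassmann_basis {0, 1})"
    using prod_list_grassmann_gen[of "[0, 1]", where 'a = 'k]
    by (subst comm_prod_one_plus_gen) simp_all
  finally have "coord (\<phi> (commutator (var 1) (var 2))) {0, 1} = 2"
    by (simp add: grassmann_scale.rep_eq coord_grassmann_basis)
  then have "\<phi> (commutator (var 1) (var 2)) \<noteq> 0"
    using assms by (auto simp: zero_grassmann.rep_eq)
  then show ?thesis
    using hom by (auto simp: identities_def)
qed

text \<open>An identity \<open>f\<close> is the difference of the central polynomials \<open>[x\<^sub>1, x\<^sub>2] + f\<close> and
  \<open>[x\<^sub>1, x\<^sub>2]\<close>, so excluding the identities from the central polynomials does not change their T-space.\<close>

lemma CP_eq: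
  assumes "(2 :: 'k::field) \<noteq> 0"
  shows "CP (grassmann_scale :: 'k \<Rightarrow> _) = T_space_gen (central_valued \<inter> free_algebra0)"
proof
  let ?s = "grassmann_scale :: 'k \<Rightarrow> 'k grassmann \<Rightarrow> 'k grassmann"
  let ?c = "commutator (var 1) (var 2) :: 'k free_algebra"
  note T = T_space_subspace[OF T_space_T_space_gen]
  show "CP ?s \<subseteq> T_space_gen (central_valued \<inter> free_algebra0)"
    unfolding CP_def
    by (rule T_space_gen_subset[OF _ T_space_T_space_gen])
      (auto simp: central_polynomials_def central_valued_def intro: T_space_gen_base)
  have c0: "?c \<in> free_algebra0"
    by (simp add: free_algebra0_def commutator_def lookup_minus augmentation_mult)
  have c: "?c \<in> CP ?s"
    unfolding CP_def
    using commutator_central_valued(1)[OF assms] commutator_not_identity[OF assms] c0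
    by (intro T_space_gen_base) (auto simp: central_polynomials_def central_valued_def)
  have "f \<in> CP ?s" if f: "f \<in> central_valued" "f \<in> free_algebra0" for f
  proof (cases "f \<in> identities ?s")
    case False
    then show ?thesis
      unfolding CP_def using f
      by (intro T_space_gen_base) (auto simp: central_polynomials_def central_valued_def)
  next
    case True
    obtain \<phi> :: "'k free_algebra \<Rightarrow> 'k grassmann" where hom: "alg_hom free_scale grassmann_scale \<phi>"
      and "\<phi> ?c \<noteq> 0"
      using commutator_not_identity[OF assms] by (auto simp: identities_def)
    moreover have "\<phi> f = 0"
      using True hom by (simp add: identities_def)
    ultimately have "\<phi> (?c + f) \<noteq> 0"
      by (simp add: alg_homD[OF hom])
    then have "?c + f \<notin> identities ?s"
      using hom by (auto simp: identities_def)
    moreover have "?c + f \<in> central_valued"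
      by (intro free.subspace_add T_space_subspace T_space_central_valued
          commutator_central_valued(1)[OF assms] f(1))
    moreover have "?c + f \<in> free_algebra0"
      using c0 f(2) by (simp add: free_algebra0_def lookup_add)
    ultimately have "?c + f \<in> CP ?s"
      unfolding CP_def
      by (intro T_space_gen_base) (auto simp: central_polynomials_def central_valued_def)
    then have "?c + f - ?c \<in> CP ?s"
      using c unfolding CP_def by (rule free.subspace_diff[OF T])
    then show ?thesis
      by simp
  qed
  then show "T_space_gen (central_valued \<inter> free_algebra0) \<subseteq> CP ?s"
    unfolding CP_def[of ?s] by (intro T_space_gen_subset T_space_T_space_gen) (auto simp: CP_def)
qed

section \<open>Sums of T-spaces and the two characteristics\<close>

lemma T_space_sum:
  assumes "T_space V" "T_space W"
  shows "T_space {f + g |f g. f \<in> V \<and> g \<in> W}"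
  unfolding T_space_def
proof (intro conjI allI impI)
  have "{f + g |f g. f \<in> V \<and> g \<in> W} = {x + y |x y. x \<in> V \<and> y \<in> W}" ..
  then show "free.subspace {f + g |f g. f \<in> V \<and> g \<in> W}"
    using free.subspace_sums[OF assms[THEN T_space_subspace]] by simp
  fix \<psi> :: "'a free_algebra \<Rightarrow> 'a free_algebra"
  assume \<psi>: "alg_hom free_scale free_scale \<psi>"
  show "\<psi> ` {f + g |f g. f \<in> V \<and> g \<in> W} \<subseteq> {f + g |f g. f \<in> V \<and> g \<in> W}"
  proof clarify
    fix f g assume "f \<in> V" "g \<in> W"
    then have "\<psi> f \<in> V" "\<psi> g \<in> W"
      using T_space_hom[OF _ \<psi>] assms by blast+
    then show "\<exists>f' g'. \<psi> (f + g) = f' + g' \<and> f' \<in> V \<and> g' \<in> W"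
      using alg_homD(1)[OF \<psi>] by blast
  qed
qed

text \<open>Constants are centrally valued but not in \<open>comm_space\<close>, so the criterion is
  applied to the sum V of \<open>comm_space\<close> and the constants. Comparing constant terms
  brings an element of \<open>free_algebra0\<close> back to \<open>comm_space\<close>.\<close>

lemma CP_char_0:
  assumes inf: "infinite (UNIV :: 'k::field set)" and char: "CHAR('k) = 0"
  shows "CP (grassmann_scale :: 'k \<Rightarrow> _) = comm_space"
proof
  have nz: "of_nat n = (0 :: 'k) \<longleftrightarrow> n = 0" for n
    using char by (simp add: of_nat_eq_0_iff_char_dvd)
  have two: "(2 :: 'k) \<noteq> 0"
    using nz[of 2] by simp
  define K where "K = range (\<lambda>c :: 'k. free_scale c 1)"
  have "T_space K"
    unfolding T_space_def
  proof (intro conjI allI impI)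
    show "free.subspace K"
      unfolding free.subspace_def K_def
      by (auto simp flip: free.scale_left_distrib intro: range_eqI[of _ _ 0])
    show "\<psi> ` K \<subseteq> K" if "alg_hom free_scale free_scale \<psi>" for \<psi>
      using that by (auto simp: K_def alg_homD)
  qed
  define V where "V = {f + g |f g. f \<in> comm_space \<and> g \<in> K}"
  have V: "T_space V"
    unfolding V_def by (intro T_space_sum \<open>T_space K\<close>) (simp add: comm_space_def T_space_T_space_gen)
  have "0 \<in> K" "1 \<in> K"
    unfolding K_def by (auto intro: range_eqI[of _ _ 0] range_eqI[of _ _ 1])
  have comm_V: "comm_space \<subseteq> V"
    using \<open>0 \<in> K\<close> unfolding V_def by force
  have "K \<subseteq> central_valued"
  proof
    fix f assume "f \<in> K"
    then obtain c where f: "f = free_scale c 1"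
      by (auto simp: K_def)
    have "grassmann_scale c 1 * a = a * grassmann_scale c (1 :: 'k grassmann)" for a
      by (simp add: grassmann_scale_mult[symmetric])
    then show "f \<in> central_valued"
      by (auto simp: central_valued_def f alg_homD center_def)
  qed
  then have V_c: "V \<subseteq> central_valued"
    using comm_space_central_valued[OF two]
      free.subspace_add[OF T_space_subspace[OF T_space_central_valued]]
    unfolding V_def by blast
  \<comment> \<open>Only the multidegree 0 vanishes in k, and its single normal form is 1.\<close>
  have closed: "norm_form n m I \<in> V"
    if "\<forall>i. of_nat (m i) = (0 :: 'k)" "I \<subseteq> {i. m i \<noteq> 0}" for n m I
  proof -
    have "m = (\<lambda>_. 0)" "I = {}"
      using that by (auto simp: nz)
    then have "norm_form n m I = (1 :: 'k free_algebra)"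
      by (simp add: norm_form_def monom_prod_zero)
    moreover have "0 + 1 \<in> V"
      unfolding V_def using \<open>1 \<in> K\<close> free.subspace_0[OF subspace_comm_space] by blast
    ultimately show ?thesis
      by simp
  qed
  have "f \<in> comm_space" if f: "f \<in> central_valued" "f \<in> free_algebra0" for f :: "'k free_algebra"
  proof -
    have "f \<in> V"
      by (rule central_valued_in_T_space[OF inf two T_space_subspace[OF V] comm_V V_c _ f(1)])
        (rule closed)
    then obtain g c where g: "f = g + free_scale c 1" "g \<in> comm_space"
      by (auto simp: V_def K_def)
    then have "c = 0"
      using f(2) augmentation_comm_space[OF g(2)]
      by (simp add: free_algebra0_def lookup_add lookup_free_scale)
    with g show ?thesis
      by simp
  qed
  then show "CP (grassmann_scale :: 'k \<Rightarrow> _) \<subseteq> comm_space"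
    unfolding CP_eq[OF two]
    by (intro T_space_gen_subset) (auto simp: comm_space_def T_space_T_space_gen)
  have "comm_space \<subseteq> T_space_gen (central_valued \<inter> (free_algebra0 :: 'k free_algebra set))"
    unfolding comm_space_def
  proof (intro T_space_gen_subset T_space_T_space_gen subsetI T_space_gen_base)
    fix f :: "'k free_algebra"
    assume f: "f \<in> {commutator (var 1) (var 2), commutator (var 1) (var 2) * commutator (var 3) (var 4)}"
    then have "f \<in> comm_space"
      unfolding comm_space_def by (rule T_space_gen_base)
    then show "f \<in> central_valued \<inter> free_algebra0"
      using comm_space_central_valued[OF two] augmentation_comm_space
      by (auto simp: free_algebra0_def)
  qed
  then show "comm_space \<subseteq> CP (grassmann_scale :: 'k \<Rightarrow> _)"
    unfolding CP_eq[OF two] .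
qed

lemma w_prod_cong: "(\<And>i. i \<in> {1..2 * n} \<Longrightarrow> y i = z i) \<Longrightarrow> w_prod p y n = w_prod p z n"
  by (induction n) (simp_all add: w_prod_Suc)

text \<open>If p divides all m_i, the normal form is congruent to y^p w_r with y an ordered monomial
  and the letters of \<open>I\<close> substituted in w_r: since dlog x_i = x_i^(-p) x_i^(p-1) dx_i,
  one p-th power per letter of \<open>I\<close> turns dlog x_i into a factor of w_r. The constants
  are covered by x_1^p.\<close>

lemma CP_char_p:
  fixes p :: nat
  defines "Y \<equiv> {commutator (var 1) (var 2), var 1 ^ p,
      commutator (var 1) (var 2) * commutator (var 3) (var 4)} :: 'k::field free_algebra set"
    and "Z \<equiv> {var (2 * n + 1) ^ p * w_poly p n |n. n \<ge> 1} :: 'k free_algebra set"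
  assumes inf: "infinite (UNIV :: 'k set)" and char: "CHAR('k) = p" "p > 2"
  shows "CP (grassmann_scale :: 'k \<Rightarrow> _) = {f + g |f g. f \<in> T_space_gen Y \<and> g \<in> T_space_gen Z}"
proof
  have nz: "of_nat n = (0 :: 'k) \<longleftrightarrow> p dvd n" for n
    using char by (simp add: of_nat_eq_0_iff_char_dvd)
  have two: "(2 :: 'k) \<noteq> 0"
    using nz[of 2] char(2) by (auto dest: dvd_imp_le)
  have odd: "odd p"
  proof
    assume "even p"
    then obtain q where q: "p = 2 * q"
      by blast
    have "(2 :: 'k) * of_nat q = 0"
      using nz[of p] by (simp add: q)
    then have "p dvd q"
      using two nz by simp
    then show False
      using q char(2) by (auto dest: dvd_imp_le)
  qed
  have p_free: "of_nat p = (0 :: 'k free_algebra)"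
    using of_nat_mult_free[of p "1 :: 'k free_algebra"] nz[of p] by simp
  define V where "V = {f + g |f g. f \<in> T_space_gen Y \<and> g \<in> T_space_gen Z}"
  have V: "T_space V"
    unfolding V_def by (intro T_space_sum T_space_T_space_gen)
  have Y_V: "T_space_gen Y \<subseteq> V" and Z_V: "T_space_gen Z \<subseteq> V"
    using free.subspace_0[OF T_space_subspace[OF T_space_T_space_gen]] unfolding V_def by force+
  have "comm_space \<subseteq> T_space_gen Y"
    unfolding comm_space_def
    by (intro T_space_gen_subset T_space_T_space_gen) (auto intro!: T_space_gen_base simp: Y_def)
  then have comm_V: "comm_space \<subseteq> V"
    using Y_V by blast
  have comm_ideal_V: "comm_ideal \<subseteq> V"
    using comm_V comm_ideal_subset by blast
  have Y0: "Y \<subseteq> central_valued \<inter> free_algebra0" and Z0: "Z \<subseteq> central_valued \<inter> free_algebra0"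
  proof -
    interpret lie_nilpotent "TYPE('k grassmann)"
      by (rule lie_nilpotent_grassmann[OF two])
    obtain \<phi> :: "'k free_algebra \<Rightarrow> 'k grassmann" where hom: "alg_hom free_scale grassmann_scale \<phi>"
      using free_algebra_hom_exists[OF algebra_scale_grassmann] by blast
    have p: "of_nat p = (0 :: 'k grassmann)"
      using alg_hom_of_nat[OF hom, of p] unfolding p_free alg_homD(5)[OF hom] by (rule sym)
    have [simp]: "Poly_Mapping.lookup (f ^ p) 0 = 0" if "Poly_Mapping.lookup f 0 = 0" for f :: "'k free_algebra"
      using that char(2) by (cases p) (simp_all add: augmentation_mult)
    have [simp]: "Poly_Mapping.lookup (var i) 0 = 0" for i
      by (simp add: var_def lookup_single zero_word_def when_def)
    show "Y \<subseteq> central_valued \<inter> free_algebra0"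
      using commutator_central_valued[OF two] power_center[OF p]
      by (auto simp: Y_def free_algebra0_def augmentation_mult commutator_def lookup_minus
          central_valued_def alg_homD)
    show "Z \<subseteq> central_valued \<inter> free_algebra0"
      using power_center[OF p] w_prod_center
      by (auto simp: Z_def free_algebra0_def augmentation_mult central_valued_def alg_homD
          w_poly_w_prod alg_hom_w_prod intro!: mult_center)
  qed
  have V_c: "V \<subseteq> central_valued"
  proof -
    have "T_space_gen Y \<subseteq> central_valued" "T_space_gen Z \<subseteq> central_valued"
      by (rule T_space_gen_subset[OF _ T_space_central_valued]; use Y0 Z0 in blast)+
    then show ?thesis
      using free.subspace_add[OF T_space_subspace[OF T_space_central_valued]]
      unfolding V_def by blast
  qed
  have closed: "norm_form n m I \<in> V"
    if m: "\<forall>i. of_nat (m i) = (0 :: 'k)" "\<forall>i. m i \<noteq> 0 \<longrightarrow> i < n" "I \<subseteq> {i. m i \<noteq> 0}" "even (card I)"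
    for n m I
  proof -
    interpret lie_nilpotent "TYPE('k comm_quot)"
      by (rule lie_nilpotent_comm_quot[OF two])
    have hom: "alg_hom free_scale comm_quot_scale (abs_comm_quot :: 'k free_algebra \<Rightarrow> _)"
      by (rule alg_hom_comm_quot)
    let ?x = "abs_comm_quot \<circ> letter :: nat \<Rightarrow> 'k comm_quot"
    have p: "of_nat p = (0 :: 'k comm_quot)"
      using alg_hom_of_nat[OF hom, of p] unfolding p_free alg_homD(5)[OF hom] by (rule sym)
    have "I \<subseteq> {..<n}"
      using m(2,3) by auto
    then have I: "finite I" "I \<subseteq> {..<n}"
      using finite_subset by auto
    define r where "r = card I div 2"
    define L where "L = sorted_list_of_set I"
    have L: "length L = 2 * r" "set L = I" "distinct L"
      using I m(4) by (auto simp: L_def r_def)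
    \<comment> \<open>\<open>w_prod\<close> numbers its arguments from 1, the list \<open>L\<close>
      from 0.\<close>
    define z where "z i = L ! (i - 1)" for i
    have L_z: "map z [1..<2 * r + 1] = L"
      by (rule nth_equalityI) (auto simp: L z_def nth_append simp del: upt_Suc)
    \<comment> \<open>For i in \<open>I\<close> the product w_r accounts for p occurrences of the
      letter, \<open>p - 1\<close> in a power and one in a commutator; so one p-th power is taken
      off m_i.\<close>
    define \<beta> where "\<beta> i = m i div p - (if i \<in> I then 1 else 0)" for i
    define y :: "'k free_algebra" where "y = monom_prod letter \<beta> n"
    have count: "count_list L i = (if i \<in> I then 1 else 0)" for i
      using L by (simp add: distinct_count_atmost_1 flip: count_mset)
    have exponent: "p * \<beta> i + (p - 1) * count_list L i = m i - (if i \<in> I then 1 else 0)" for i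
    proof -
      obtain q where q: "m i = p * q"
        using m(1) nz by blast
      have "q \<noteq> 0" if "i \<in> I"
        using that m(3) q by (cases "q = 0") auto
      then show ?thesis
        using char(2) by (cases q) (auto simp: q \<beta>_def count algebra_simps)
    qed
    have "abs_comm_quot (y ^ p * w_prod p (letter \<circ> z) r) = abs_comm_quot (norm_form n m I)"
    proof -
      have z: "\<forall>i\<in>{1..2 * r}. z i < n"
      proof
        fix i assume "i \<in> {1..2 * r}"
        then have "L ! (i - 1) \<in> set L"
          by (intro nth_mem) (auto simp: L(1))
        then show "z i < n"
          using I(2) by (auto simp: z_def L(2))
      qed
      have "abs_comm_quot (y ^ p * w_prod p (letter \<circ> z) r) =
          monom_prod ?x (\<lambda>i. p * \<beta> i) n * w_prod p (?x \<circ> z) r"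
        by (simp add: y_def alg_homD[OF hom] alg_hom_monom_prod[OF hom] alg_hom_w_prod[OF hom]
            monom_prod_power[OF p odd] o_assoc)
      also have "\<dots> = monom_prod ?x (\<lambda>i. p * \<beta> i + (p - 1) * count_list L i) n * comm_prod ?x L"
        using monom_prod_w_prod[OF z, of ?x "\<lambda>i. p * \<beta> i" p] unfolding L_z .
      also have "\<dots> = abs_comm_quot (norm_form n m I)"
        unfolding exponent
        unfolding norm_form_def alg_homD[OF hom] alg_hom_monom_prod[OF hom]
          alg_hom_comm_prod[OF hom] L_def ..
      finally show ?thesis .
    qed
    moreover have "y ^ p * w_prod p (letter \<circ> z) r \<in> V"
    \<comment> \<open>The second family of generators begins with n = 1, so a bare p-th power has to
      come from x_1^p.\<close>
    proof (cases "r = 0")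
      case True
      obtain \<psi> :: "'k free_algebra \<Rightarrow> 'k free_algebra"
        where \<psi>: "alg_hom free_scale free_scale \<psi>" "\<And>i. \<psi> (letter i) = y"
        using free_algebra_hom_exists[OF algebra_scale_free, of "\<lambda>_. y"] by blast
      have "\<psi> (var 1 ^ p) \<in> T_space_gen Y"
        by (intro T_space_hom[OF T_space_T_space_gen \<psi>(1)] T_space_gen_base) (simp add: Y_def)
      then show ?thesis
        using Y_V True by (auto simp: alg_homD[OF \<psi>(1)] var_letter \<psi>(2))
    next
      case False
      \<comment> \<open>\<open>letter (2 * r)\<close> is x_(2r+1), the variable of the p-th power;
        the letters before it are the arguments of w_r.\<close>
      define x where "x i = (if i = 2 * r then y else letter (L ! i))" for i
      obtain \<psi> :: "'k free_algebra \<Rightarrow> 'k free_algebra"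
        where \<psi>: "alg_hom free_scale free_scale \<psi>" "\<And>i. \<psi> (letter i) = x i"
        using free_algebra_hom_exists[OF algebra_scale_free, of x] by blast
      have "\<psi> (var (2 * r + 1) ^ p * w_poly p r) \<in> T_space_gen Z"
        using False
        by (intro T_space_hom[OF T_space_T_space_gen \<psi>(1)] T_space_gen_base) (auto simp: Z_def)
      moreover have "\<psi> (w_poly p r) = w_prod p (letter \<circ> z) r"
        unfolding w_poly_w_prod alg_hom_w_prod[OF \<psi>(1)]
        by (rule w_prod_cong) (auto simp: var_letter \<psi>(2) x_def z_def)
      ultimately show ?thesis
        using Z_V by (auto simp: alg_homD[OF \<psi>(1)] var_letter \<psi>(2) x_def)
    qed
    ultimately show ?thesis
      using quot_eq_in_subspace[OF sym T_space_subspace[OF V] comm_ideal_V] by blast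
  qed
  have "central_valued \<inter> free_algebra0 \<subseteq> V"
    using central_valued_in_T_space[OF inf two T_space_subspace[OF V] comm_V V_c closed] by blast
  then show "CP (grassmann_scale :: 'k \<Rightarrow> _) \<subseteq> {f + g |f g. f \<in> T_space_gen Y \<and> g \<in> T_space_gen Z}"
    unfolding CP_eq[OF two] V_def[symmetric] using V by (rule T_space_gen_subset)
  have "T_space_gen Y \<subseteq> T_space_gen (central_valued \<inter> free_algebra0)"
    "T_space_gen Z \<subseteq> T_space_gen (central_valued \<inter> free_algebra0)"
    by (rule T_space_gen_subset[OF _ T_space_T_space_gen]; use Y0 Z0 T_space_gen_base in blast)+
  then show "{f + g |f g. f \<in> T_space_gen Y \<and> g \<in> T_space_gen Z} \<subseteq> CP (grassmann_scale :: 'k \<Rightarrow> _)"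
    unfolding CP_eq[OF two]
    using free.subspace_add[OF T_space_subspace[OF T_space_T_space_gen]] by blast
qed

theorem corollary3p3:
  assumes "infinite (UNIV :: 'k::field set)"
  shows "(CHAR('k) = 0 \<longrightarrow>
      CP (grassmann_scale :: 'k \<Rightarrow> 'k grassmann \<Rightarrow> 'k grassmann) =
        T_space_gen {commutator (var 1) (var 2),
                     commutator (var 1) (var 2) * commutator (var 3) (var 4)}) \<and>
    (\<forall>p. CHAR('k) = p \<and> p > 2 \<longrightarrow>
      CP (grassmann_scale :: 'k \<Rightarrow> 'k grassmann \<Rightarrow> 'k grassmann) =
        {f + g |f g.
           f \<in> T_space_gen {commutator (var 1) (var 2), var 1 ^ p,
                             commutator (var 1) (var 2) * commutator (var 3) (var 4)} \<and>
           g \<in> T_space_gen {var (2 * n + 1) ^ p * w_poly p n |n. n \<ge> 1}})"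
proof (intro conjI allI impI, goal_cases)
  case 1
  then show ?case
    using CP_char_0[OF assms] by (simp add: comm_space_def)
next
  case (2 p)
  then show ?case
    by (intro CP_char_p[OF assms]) simp_all
qed

end
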